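(* Let $n\ge3$, $\alpha<1$, $M>0$, and let $u=P_\alpha[\phi]$ in $\mathbb{B}^n$ with $\phi\in L^\infty(\mathbb{S}^{n-1},\mathbb{R}^n)$, $\|\phi\|_{L^\infty(\mathbb{S}^{n-1},\mathbb{R}^n)}\le M$. Suppose $u(0)=0$ and $J_u(0)=1$. Let $r_0\in(0,1)$ be the smallest positive root of $$M^n\, r\, G(r)=\Big(\frac{\sqrt\pi\,\Gamma(\frac{n+1}{2})}{(n-\alpha)C_{n,\alpha}\Gamma(\frac n2)}\Big)^{n-1}.$$ Then $u$ is univalent in $\mathbb{B}^n(r_0)$ and $u(\mathbb{B}^n(r_0))\supset\mathbb{B}^n(R_0)$, where $R_0=\frac M2 r_0^2 G(r_0)$.
   Context: $n\ge3$; $\mathbb{B}^n(r)=\{x\in\mathbb{R}^n:|x|<r\}$, $\mathbb{B}^n=\mathbb{B}^n(1)$, $\mathbb{S}^{n-1}$ the unit sphere with normalized surface measure $\sigma$. For $\alpha<1$, $P_\alpha(x,\zeta)=C_{n,\alpha}\frac{(1-|x|^2)^{1-\alpha}}{|x-\zeta|^{n-\alpha}}$ with $C_{n,\alpha}=\frac{\Gamma(\frac{n-\alpha}{2})\Gamma(1-\frac\alpha2)}{\Gamma(\frac n2)\Gamma(1-\alpha)}$, and for vector-valued $\phi$, $P_\alpha[\phi](x)=\int_{\mathbb{S}^{n-1}}P_\alpha(x,\zeta)\phi(\zeta)\,d\sigma(\zeta)$ (componentwise). $\|\phi\|_{L^\infty}$ is the essential supremum of $|\phi|$. $J_u(x)=\det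 Du(x)$ is the Jacobian determinant. For $r\in[0,1)$, $$G(r)=\frac{2(1-\alpha)C_{n,\alpha}}{1-r^2}\max_{0\le t\le r}{}_2F_1\Big(\tfrac\alpha2,\tfrac{n+\alpha}{2}-1;\tfrac n2;t^2\Big)+\frac{(n-\alpha)C_{n,\alpha}}{(1-r^2)^2}\max_{0\le t\le r}{}_2F_1\Big(\tfrac\alpha2-1,\tfrac{n+\alpha}{2}-2;\tfrac n2;t^2\Big)$$ $$+\frac{(n-\alpha)C_{n,\alpha}}{(1-r^2)^{3-\alpha}}\max_{0\le t\le r}\Big\{{}_2F_1\Big(\tfrac\alpha2-1,\tfrac{n+\alpha}{2}-2;\tfrac n2;t^2\Big)g(t)\Big\},$$ where $g(t)=\big(2(1+t^2)^{\frac{n+2-\alpha}{2}}-(1-t)^{n+2-\alpha}-(1-t^2)^{1-\alpha}\big)/t$ for $t\in(0,1)$ and $g(0)=n+2-\alpha$. ${}_2F_1$ is the Gauss hypergeometric series. *)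

theory Defs
  imports "HOL-Analysis.Analysis"
begin

text \<open>Normalized surface measure on the unit sphere of R^n, realised as the
  push-forward of the normalized Lebesgue measure on the unit ball under the
  radial projection x \<mapsto> x/|x| (the null point 0 is sent to a fixed sphere point).\<close>
definition sphere_measure :: "(real^'n) measure" where
  "sphere_measure =
     distr (uniform_measure lborel (ball 0 1)) (restrict_space borel (sphere 0 1))
       (\<lambda>x. if x = 0 then (SOME e. e \<in> sphere (0::real^'n) 1) else x /\<^sub>R norm x)"

definition C_const :: "nat \<Rightarrow> real \<Rightarrow> real" where
  "C_const n \<alpha> = Gamma ((real n - \<alpha>) / 2) * Gamma (1 - \<alpha> / 2)
                   / (Gamma (real n / 2) * Gamma (1 - \<alpha>))"

definition P_kernel :: "real \<Rightarrow> real^'n \<Rightarrow> real^'n \<Rightarrow> real" where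
  "P_kernel \<alpha> x \<zeta> = C_const CARD('n) \<alpha> * (1 - (norm x)\<^sup>2) powr (1 - \<alpha>)
                        / (norm (x - \<zeta>)) powr (real CARD('n) - \<alpha>)"

definition P_integral :: "real \<Rightarrow> (real^'n \<Rightarrow> real^'n) \<Rightarrow> real^'n \<Rightarrow> real^'n" where
  "P_integral \<alpha> \<phi> x = integral\<^sup>L sphere_measure (\<lambda>\<zeta>. P_kernel \<alpha> x \<zeta> *\<^sub>R \<phi> \<zeta>)"

definition hyp2F1 :: "real \<Rightarrow> real \<Rightarrow> real \<Rightarrow> real \<Rightarrow> real" where
  "hyp2F1 a b c z = (\<Sum>k. pochhammer a k * pochhammer b k / (pochhammer c k * fact k) * z ^ k)"

definition g_fun :: "nat \<Rightarrow> real \<Rightarrow> real \<Rightarrow> real" where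
  "g_fun n \<alpha> t = (if t = 0 then real n + 2 - \<alpha>
     else (2 * (1 + t\<^sup>2) powr ((real n + 2 - \<alpha>) / 2) - (1 - t) powr (real n + 2 - \<alpha>)
           - (1 - t\<^sup>2) powr (1 - \<alpha>)) / t)"

definition G_fun :: "nat \<Rightarrow> real \<Rightarrow> real \<Rightarrow> real" where
  "G_fun n \<alpha> r =
     2 * (1 - \<alpha>) * C_const n \<alpha> / (1 - r\<^sup>2)
       * (SUP t\<in>{0..r}. hyp2F1 (\<alpha>/2) ((real n + \<alpha>)/2 - 1) (real n / 2) (t\<^sup>2))
   + (real n - \<alpha>) * C_const n \<alpha> / (1 - r\<^sup>2)\<^sup>2
       * (SUP t\<in>{0..r}. hyp2F1 (\<alpha>/2 - 1) ((real n + \<alpha>)/2 - 2) (real n / 2) (t\<^sup>2))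
   + (real n - \<alpha>) * C_const n \<alpha> / (1 - r\<^sup>2) powr (3 - \<alpha>)
       * (SUP t\<in>{0..r}. hyp2F1 (\<alpha>/2 - 1) ((real n + \<alpha>)/2 - 2) (real n / 2) (t\<^sup>2) * g_fun n \<alpha> t)"

end

theory Submission
  imports Defs "HOL-Probability.Probability_Measure" "HOL-Real_Asymp.Real_Asymp"
begin

text \<open>
  Write \<open>s = n - \<alpha>\<close>, \<open>N = s C M\<close> and \<open>K = M r\<^sub>0 G(r\<^sub>0)\<close>. The derivative \<open>D\<close> of \<open>u\<close> at the origin is
  \<open>s C\<close> times the matrix of first moments of \<open>\<phi>\<close>, so Bessel's inequality bounds its Hilbert-Schmidt norm
  by \<open>N / \<surd>n\<close>. Together with \<open>det D = 1\<close>, Hadamard's inequality and AM-GM this gives \<open>N \<ge> n\<close> and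
  \<open>|D h| \<ge> \<surd>2 K |h|\<close>, which is better than the bound \<open>K |h|\<close> that the sharp estimate of the operator
  norm of \<open>D\<close> would give.

  Estimating the suprema in \<open>G\<close> by the values at \<open>t = 0\<close> gives \<open>G \<ge> C (2(1 - \<alpha>) + s + s(s + 2))\<close>, and then
  \<open>N \<ge> n\<close> forces \<open>r\<^sub>0 (s + 3) \<le> 1/6\<close>. On such a small ball a pointwise estimate of the gradient of
  the kernel yields \<open>|Du(x) - Du(0)| \<le> 5/4 M |x| G(r\<^sub>0)\<close>; the factor \<open>5/4\<close> is absorbed by \<open>\<surd>2\<close>, and no
  integral of the kernel over the sphere has to be evaluated. Univalence follows at once, and the
  covering statement from invariance of domain.
\<close>

section \<open>Determinant inequalities\<close>

text \<open>With orthogonal rows the Gram matrix \<open>A ** transpose A\<close> is diagonal, and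
  its determinant is the square of \<open>det A\<close>.\<close>

lemma det_square_orthogonal_rows:
  fixes A :: "real^'n^'n"
  assumes "\<And>i j. i \<noteq> j \<Longrightarrow> A $ i \<bullet> A $ j = 0"
  shows "(det A)\<^sup>2 = (\<Prod>i\<in>UNIV. (norm (A $ i))\<^sup>2)"
proof -
  have "(det A)\<^sup>2 = det (A ** transpose A)"
    by (simp add: det_mul det_transpose power2_eq_square)
  also have "\<dots> = (\<Prod>i\<in>UNIV. (A ** transpose A) $ i $ i)"
    using assms by (intro det_diagonal) (simp add: matrix_mult_transpose_dot_row row_def)
  also have "\<dots> = (\<Prod>i\<in>UNIV. (norm (A $ i))\<^sup>2)"
    by (simp add: matrix_mult_transpose_dot_row row_def power2_norm_eq_inner)
  finally show ?thesis .
qed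

text \<open>Gram-Schmidt without normalisation, one row at a time. The new row loses its projection
  onto the span of the rows in \<open>S\<close>: subtracting an element of the span of other rows
  keeps the determinant, and by Pythagoras the row does not get longer.\<close>

lemma orthogonalize_rows:
  fixes A :: "real^'n^'n"
  assumes "finite S"
  shows "\<exists>B. det B = det A \<and> (\<forall>i. norm (B $ i) \<le> norm (A $ i)) \<and>
             (\<forall>i\<in>S. \<forall>j\<in>S. i \<noteq> j \<longrightarrow> B $ i \<bullet> B $ j = 0)"
  using assms
proof (induction S rule: finite_induct)
  case empty
  then show ?case by auto
next
  case (insert k S)
  then obtain B where B: "det B = det A" "\<And>i. norm (B $ i) \<le> norm (A $ i)"
    "\<And>i j. i \<in> S \<Longrightarrow> j \<in> S \<Longrightarrow> i \<noteq> j \<Longrightarrow> B $ i \<bullet> B $ j = 0" by blast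
  obtain y z where y: "y \<in> span ((\<lambda>j. B $ j) ` S)"
    and z: "\<And>w. w \<in> span ((\<lambda>j. B $ j) ` S) \<Longrightarrow> orthogonal z w" and yz: "B $ k = y + z"
    using orthogonal_subspace_decomp_exists[of "(\<lambda>j. B $ j) ` S" "B $ k"] by metis
  define B' :: "real^'n^'n" where "B' = (\<chi> i. if i = k then row k B + - y else row i B)"
  have "(\<lambda>j. B $ j) ` S \<subseteq> {row j B |j. j \<noteq> k}"
    using insert.hyps by (auto simp: row_def)
  then have "y \<in> span {row j B |j. j \<noteq> k}"
    using y span_mono by blast
  then have "- y \<in> vec.span {row j B |j. j \<noteq> k}"
    by (simp add: span_vec_eq span_neg)
  then have dB': "det B' = det A"
    unfolding B'_def using det_row_span[of "- y" B k] B(1) by simp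
  have B'k: "B' $ k = z" and B'i: "\<And>i. i \<noteq> k \<Longrightarrow> B' $ i = B $ i"
    using yz by (auto simp: B'_def row_def vec_eq_iff)
  have nB': "norm (B' $ i) \<le> norm (A $ i)" for i
  proof (cases "i = k")
    case True
    have "(norm (B $ k))\<^sup>2 = (norm y)\<^sup>2 + (norm z)\<^sup>2"
      unfolding yz using z[OF y]
      by (intro norm_add_Pythagorean) (simp add: orthogonal_commute)
    then have "(norm z)\<^sup>2 \<le> (norm (B $ k))\<^sup>2" by simp
    then have "norm z \<le> norm (B $ k)" by (rule power2_le_imp_le) simp
    with True B'k B(2)[of k] show ?thesis by simp
  qed (use B'i B(2) in simp)
  have zj: "z \<bullet> B $ j = 0" if "j \<in> S" for j
    using z[OF span_base, of "B $ j"] that by (auto simp: orthogonal_def)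
  have "B' $ i \<bullet> B' $ j = 0" if "i \<in> insert k S" "j \<in> insert k S" "i \<noteq> j" for i j
  proof (cases "i = k")
    case True
    then show ?thesis using that zj by (simp add: B'k B'i)
  next
    case False
    then show ?thesis
      using that zj[of i] B(3)[of i j] by (cases "j = k") (auto simp: B'k B'i inner_commute)
  qed
  with dB' nB' show ?case by blast
qed

text \<open>Orthogonalising the rows keeps the left side and does not increase the right side; for
  orthogonal rows the two sides agree.\<close>

lemma Hadamard_rows:
  fixes A :: "real^'n^'n"
  shows "(det A)\<^sup>2 \<le> (\<Prod>i\<in>UNIV. (norm (A $ i))\<^sup>2)"
proof -
  obtain B where B: "det B = det A" "\<And>i. norm (B $ i) \<le> norm (A $ i)"
    "\<And>i j. i \<noteq> j \<Longrightarrow> B $ i \<bullet> B $ j = 0"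
    using orthogonalize_rows[of UNIV A] by auto
  then have "(det A)\<^sup>2 = (\<Prod>i\<in>UNIV. (norm (B $ i))\<^sup>2)"
    using det_square_orthogonal_rows by metis
  also have "\<dots> \<le> (\<Prod>i\<in>UNIV. (norm (A $ i))\<^sup>2)"
    using B(2) by (intro prod_mono) (simp add: power_mono)
  finally show ?thesis .
qed

lemma prod_le_power_mean:
  fixes x :: "'a \<Rightarrow> real"
  assumes "finite S" "S \<noteq> {}" "\<And>i. i \<in> S \<Longrightarrow> x i \<ge> 0"
  shows "(\<Prod>i\<in>S. x i) \<le> ((\<Sum>i\<in>S. x i) / card S) ^ card S"
proof -
  have c: "card S > 0" using assms by (simp add: card_gt_0_iff)
  have p: "(\<Prod>i\<in>S. x i) \<ge> 0" using assms by (simp add: prod_nonneg)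
  have "(\<Prod>i\<in>S. x i) = ((\<Prod>i\<in>S. x i) powr (1 / card S)) ^ card S"
    using c p by (cases "prod x S = 0") (auto simp: powr_realpow[symmetric] powr_powr simp del: prod_zero_iff)
  also have "\<dots> \<le> (\<Sum>i\<in>S. x i / card S) ^ card S"
    using arith_geom_mean[OF assms] by (intro power_mono) auto
  finally show ?thesis by (simp add: sum_divide_distrib)
qed

lemma norm_vec_square: "(norm (x :: ('a::real_normed_vector)^'n))\<^sup>2 = (\<Sum>i\<in>UNIV. (norm (x $ i))\<^sup>2)"
  by (simp add: norm_vec_def L2_set_def sum_nonneg)

text \<open>The norm of a matrix is here the Hilbert-Schmidt norm, so its square is the sum of the
  squared row lengths and AM-GM applies to Hadamard's product.\<close>

lemma det_square_le_norm:
  fixes A :: "real^'n^'n"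
  shows "(det A)\<^sup>2 \<le> ((norm A)\<^sup>2 / CARD('n)) ^ CARD('n)"
  using order_trans[OF Hadamard_rows[of A] prod_le_power_mean[of UNIV "\<lambda>i. (norm (A $ i))\<^sup>2"]]
  by (simp add: norm_vec_square[of A])

lemma norm_transpose: "norm (transpose A) = norm (A :: real^'n^'m)"
proof -
  have "(norm (transpose A))\<^sup>2 = (norm A)\<^sup>2"
    by (simp add: norm_vec_square transpose_def) (rule sum.swap)
  then show ?thesis by simp
qed

text \<open>The squared norm can be summed over columns, and \<open>Q\<close> moves each column
  isometrically.\<close>

lemma norm_orthogonal_matrix_mult:
  fixes Q :: "real^'n^'n" and A :: "real^'m^'n"
  assumes "orthogonal_matrix Q"
  shows "norm (Q ** A) = norm A"
proof -
  have col: "(norm B)\<^sup>2 = (\<Sum>j\<in>UNIV. (norm (column j B))\<^sup>2)" for B :: "real^'m^'n"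
  proof -
    have "(norm B)\<^sup>2 = (\<Sum>j\<in>UNIV. (norm (transpose B $ j))\<^sup>2)"
      using norm_vec_square[of "transpose B"] by (simp add: norm_transpose)
    then show ?thesis by (simp add: transpose_def column_def)
  qed
  have "column j (Q ** A) = Q *v column j A" for j
    by (simp add: column_def matrix_matrix_mult_def matrix_vector_mult_def vec_eq_iff)
  moreover have "norm (Q *v v) = norm v" for v
    using assms orthogonal_transformation_matrix[of "(*v) Q"]
    by (auto simp: orthogonal_transformation)
  ultimately have "(norm (Q ** A))\<^sup>2 = (norm A)\<^sup>2" by (simp add: col)
  then show ?thesis by simp
qed

text \<open>For a given determinant and a bounded Hilbert-Schmidt norm this bounds
  \<open>A *v h\<close> from below. In an orthonormal basis containing \<open>h\<close>, the vector
  \<open>A *v h\<close> is one column of the matrix; Hadamard's product keeps that factor, and AM-GM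
  is applied to the remaining n - 1.\<close>

lemma det_square_le_norm_mult_vec:
  fixes A :: "real^'n^'n"
  assumes "CARD('n) \<ge> 2" "norm h = 1"
  shows "(det A)\<^sup>2 \<le> (norm (A *v h))\<^sup>2 * ((norm A)\<^sup>2 / (real CARD('n) - 1)) ^ (CARD('n) - 1)"
proof -
  fix k :: 'n
  obtain Q :: "real^'n^'n" where Q: "orthogonal_matrix Q" "Q *v axis k 1 = h"
    using orthogonal_matrix_exists_basis[OF assms(2)] by metis
  \<comment> \<open>The transpose turns the columns of \<open>A ** Q\<close>, one of which is
    \<open>A *v h\<close>, into rows, as \<open>Hadamard_rows\<close> requires.\<close>
  define B where "B = transpose (A ** Q)"
  have nB: "norm B = norm A"
  proof -
    have "B = transpose Q ** transpose A" by (simp add: B_def matrix_transpose_mul)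
    then show ?thesis
      using Q(1) norm_orthogonal_matrix_mult[of "transpose Q" "transpose A"]
      by (simp add: norm_transpose)
  qed
  have Bk: "B $ k = A *v h"
    unfolding Q(2)[symmetric] matrix_vector_mul_assoc
    by (simp add: B_def transpose_def column_def matrix_vector_mult_basis)
  have dB: "(det B)\<^sup>2 = (det A)\<^sup>2"
    using det_orthogonal_matrix[OF Q(1)] by (auto simp: B_def det_transpose det_mul)
  have "(\<Prod>i\<in>UNIV - {k}. (norm (B $ i))\<^sup>2)
      \<le> ((\<Sum>i\<in>UNIV - {k}. (norm (B $ i))\<^sup>2) / card (UNIV - {k})) ^ card (UNIV - {k})"
  proof (intro prod_le_power_mean)
    have "card (UNIV - {k}) > 0" using assms(1) by simp
    then show "UNIV - {k} \<noteq> {}" by (metis card.empty less_irrefl)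
  qed auto
  also have "\<dots> \<le> ((norm A)\<^sup>2 / card (UNIV - {k})) ^ card (UNIV - {k})"
    unfolding nB[symmetric] norm_vec_square[of B]
    by (intro power_mono divide_right_mono sum_mono2 divide_nonneg_nonneg sum_nonneg) auto
  finally have le: "(\<Prod>i\<in>UNIV - {k}. (norm (B $ i))\<^sup>2)
      \<le> ((norm A)\<^sup>2 / (real CARD('n) - 1)) ^ (CARD('n) - 1)"
    using assms(1) by (simp add: of_nat_diff)
  have "(det A)\<^sup>2 \<le> (\<Prod>i\<in>UNIV. (norm (B $ i))\<^sup>2)"
    using Hadamard_rows[of B] dB by simp
  also have "\<dots> = (norm (A *v h))\<^sup>2 * (\<Prod>i\<in>UNIV - {k}. (norm (B $ i))\<^sup>2)"
    by (simp add: prod.remove[of UNIV k] Bk)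
  finally show ?thesis
    using le by (meson mult_left_mono order_trans zero_le_power2)
qed

section \<open>The surface measure\<close>

abbreviation radial_projection :: "real^'n \<Rightarrow> real^'n" where
  "radial_projection x \<equiv> (if x = 0 then (SOME e. e \<in> sphere (0::real^'n) 1) else x /\<^sub>R norm x)"

lemma radial_projection_in_sphere: "radial_projection (x :: real^'n) \<in> sphere 0 1"
proof -
  have "(SOME e. e \<in> sphere (0::real^'n) 1) \<in> sphere 0 1"
    by (rule someI[of _ "axis undefined 1"]) simp
  then show ?thesis by auto
qed

lemma measurable_radial_projection [measurable]:
  "radial_projection \<in> borel \<rightarrow>\<^sub>M restrict_space borel (sphere (0::real^'n) 1)"
proof (rule measurable_restrict_space2)
  show "radial_projection \<in> space borel \<rightarrow> sphere (0::real^'n) 1"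
    using radial_projection_in_sphere by blast
qed simp

lemma measurable_radial_projection_uniform:
  "radial_projection \<in> uniform_measure lborel (ball 0 1) \<rightarrow>\<^sub>M restrict_space borel (sphere (0::real^'n) 1)"
  by (subst measurable_cong_sets[OF _ refl, of _ borel]) (simp, rule measurable_radial_projection)

lemma prob_space_sphere_measure: "prob_space (sphere_measure :: (real^'n) measure)"
  unfolding sphere_measure_def
proof (rule prob_space.prob_space_distr)
  show "prob_space (uniform_measure lborel (ball (0::real^'n) 1))"
    by (rule prob_space_uniform_measure) (use unit_ball_vol_pos[of "real CARD('n)"] in \<open>auto simp: emeasure_ball simp del: unit_ball_vol_pos\<close>)
qed (rule measurable_radial_projection_uniform)

lemma space_sphere_measure [simp]: "space sphere_measure = sphere (0::real^'n) 1"
  by (simp add: sphere_measure_def space_restrict_space)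

lemma sets_sphere_measure [measurable_cong]:
  "sets sphere_measure = sets (restrict_space borel (sphere (0::real^'n) 1))"
  by (simp add: sphere_measure_def)

lemma borel_measurable_sphere_measure:
  assumes "f \<in> borel_measurable borel"
  shows "f \<in> borel_measurable (sphere_measure :: (real^'n) measure)"
  using measurable_restrict_space1[OF assms, of "sphere 0 1"]
  by (simp add: measurable_cong_sets[OF sets_sphere_measure refl])

lemma integrable_sphere_measure_bounded:
  fixes f :: "real^'n \<Rightarrow> 'b::{banach, second_countable_topology}"
  assumes "f \<in> borel_measurable sphere_measure" "AE \<zeta> in sphere_measure. norm (f \<zeta>) \<le> B"
  shows "integrable sphere_measure f"
proof -
  interpret prob_space "sphere_measure :: (real^'n) measure" by (rule prob_space_sphere_measure)
  show ?thesis using assms by (intro integrable_const_bound[of _ B]) auto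
qed

text \<open>Turns integrals over the sphere into Lebesgue integrals over the ball, where the
  symmetries of \<open>lborel\<close> are available.\<close>

lemma integral_sphere_measure:
  fixes f :: "real^'n \<Rightarrow> real"
  assumes [measurable]: "f \<in> borel_measurable borel"
  shows "integral\<^sup>L sphere_measure f
    = (\<integral>x. indicator (ball 0 1) x * f (radial_projection x) \<partial>lborel) / measure lborel (ball (0::real^'n) 1)"
proof -
  let ?c = "measure lborel (ball (0::real^'n) 1)"
  have c: "emeasure lborel (ball (0::real^'n) 1) = ennreal ?c" "?c > 0"
    by (auto simp: emeasure_ball content_ball measure_def)
  have "integral\<^sup>L sphere_measure f = (\<integral>x. f (radial_projection x) \<partial>uniform_measure lborel (ball 0 1))"
    unfolding sphere_measure_def
    by (intro integral_distr measurable_radial_projection_uniform measurable_restrict_space1) simp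
  also have "uniform_measure lborel (ball (0::real^'n) 1)
      = density lborel (\<lambda>x. ennreal (indicator (ball 0 1) x / ?c))"
    unfolding uniform_measure_def c using c(2)
    by (intro density_cong borel_measurable_divide borel_measurable_indicator borel_measurable_const
        measurable_compose[OF _ measurable_ennreal] borel_measurable_divide_ennreal)
      (auto simp: divide_ennreal simp flip: ennreal_indicator)
  also have "(\<integral>x. f (radial_projection x) \<partial>\<dots>)
      = (\<integral>x. (indicator (ball 0 1) x / ?c) *\<^sub>R f (radial_projection x) \<partial>lborel)"
  proof (rule integral_density)
    show "(\<lambda>x. f (radial_projection x)) \<in> borel_measurable lborel"
      using measurable_compose[OF measurable_radial_projection measurable_restrict_space1[OF assms]]
      by simp
    show "(\<lambda>x. indicator (ball 0 1) x / ?c) \<in> borel_measurable (lborel :: (real^'n) measure)"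
      by (intro borel_measurable_divide borel_measurable_indicator) auto
  qed (use c(2) in auto)
  finally show ?thesis by simp
qed

text \<open>A linear isometry preserves the unit ball and commutes with the radial projection away
  from 0, so its invariance of Lebesgue measure passes to the sphere. It is applied to coordinate
  swaps and reflections.\<close>

lemma sphere_measure_isometry_invariant:
  fixes f :: "real^'n \<Rightarrow> real" and T :: "real^'n \<Rightarrow> real^'n"
  assumes [measurable]: "f \<in> borel_measurable borel" and T: "linear T" "\<And>x. norm (T x) = norm x"
    and inv: "distr lborel borel T = lborel"
  shows "integral\<^sup>L sphere_measure (\<lambda>\<zeta>. f (T \<zeta>)) = integral\<^sup>L sphere_measure f"
proof -
  have cT: "continuous_on UNIV T" by (simp add: T(1) linear_continuous_on linear_conv_bounded_linear[symmetric])
  then have [measurable]: "T \<in> borel_measurable borel" by (rule borel_measurable_continuous_onI)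
  have T0: "T x = 0 \<longleftrightarrow> x = 0" for x using T(2)[of x] by (metis norm_eq_zero)
  have m: "(\<lambda>x. f (radial_projection x)) \<in> borel_measurable borel"
    using measurable_compose[OF measurable_radial_projection measurable_restrict_space1[OF assms(1)]]
    by simp
  have "(\<integral>x. indicator (ball 0 1) x * f (radial_projection x) \<partial>lborel)
      = (\<integral>x. indicator (ball 0 1) x * f (radial_projection x) \<partial>distr lborel borel T)"
    by (simp add: inv)
  also have "\<dots> = (\<integral>x. indicator (ball 0 1) (T x) * f (radial_projection (T x)) \<partial>lborel)"
    by (intro integral_distr borel_measurable_times m borel_measurable_indicator) auto
  also have "\<dots> = (\<integral>x. indicator (ball 0 1) x * f (T (radial_projection x)) \<partial>lborel)"
  \<comment> \<open>At the origin the projection has an arbitrarily chosen value, which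
    \<open>T\<close> may move; hence equality only almost everywhere.\<close>
  proof (rule integral_cong_AE)
    show "AE x in lborel. indicator (ball 0 1) (T x) * f (radial_projection (T x))
        = indicator (ball 0 1) x * f (T (radial_projection x))"
      using AE_lborel_singleton[of "0::real^'n"]
      by eventually_elim (auto simp: T0 T(2) linear_scale[OF T(1)] indicator_def)
    show "(\<lambda>x. indicator (ball 0 1) (T x) * f (radial_projection (T x))) \<in> borel_measurable lborel"
      unfolding measurable_lborel2
      by (intro borel_measurable_times measurable_compose[OF \<open>T \<in> borel_measurable borel\<close> m]
          measurable_compose[OF \<open>T \<in> borel_measurable borel\<close> borel_measurable_indicator]) simp
    show "(\<lambda>x. indicator (ball 0 1) x * f (T (radial_projection x))) \<in> borel_measurable lborel"
      unfolding measurable_lborel2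
      by (intro borel_measurable_times borel_measurable_indicator
          measurable_compose[OF measurable_radial_projection measurable_restrict_space1[OF
              measurable_compose[OF \<open>T \<in> borel_measurable borel\<close> assms(1)]]]) simp
  qed
  finally show ?thesis
    by (simp add: integral_sphere_measure)
qed

section \<open>Coordinate symmetries of Lebesgue measure and second moments on the sphere\<close>

lemma prod_Basis_cart: "(\<Prod>b\<in>Basis. (x :: real^'n) \<bullet> b) = (\<Prod>i\<in>UNIV. x $ i)"
proof -
  have B: "(Basis :: (real^'n) set) = (\<lambda>i. axis i 1) ` UNIV" by (auto simp: Basis_vec_def)
  have "inj (\<lambda>i. axis i 1 :: real^'n)" by (auto simp: inj_on_def axis_eq_axis)
  then show ?thesis by (simp add: B prod.reindex cart_eq_inner_axis)
qed

text \<open>Lebesgue measure is determined by its values on boxes, and the preimage of a box under a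
  coordinate swap is a box with the same side lengths in another order.\<close>

lemma lborel_transpose_invariant:
  fixes i j :: "'n::finite"
  shows "distr lborel borel (\<lambda>x::real^'n. \<chi> k. x $ Transposition.transpose i j k) = lborel"
proof (rule lborel_eqI[symmetric])
  let ?T = "\<lambda>x::real^'n. \<chi> k. x $ Transposition.transpose i j k"
  fix l u :: "real^'n"
  assume "\<And>b. b \<in> Basis \<Longrightarrow> l \<bullet> b \<le> u \<bullet> b"
  then have le: "l $ k \<le> u $ k" for k by (simp add: cart_eq_inner_axis axis_in_Basis_iff)
  have tt: "(\<forall>k. P (Transposition.transpose i j k)) \<longleftrightarrow> (\<forall>k. P k)" for P
    by (metis transpose_involutory)
  have "?T -` box l u = box (?T l) (?T u)"
  proof (intro set_eqI)
    fix x
    show "x \<in> ?T -` box l u \<longleftrightarrow> x \<in> box (?T l) (?T u)"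
      using tt[of "\<lambda>k. l $ Transposition.transpose i j k < x $ k \<and> x $ k < u $ Transposition.transpose i j k"]
      by (simp add: mem_box_cart)
  qed
  moreover have "?T \<in> borel_measurable borel"
    by (intro borel_measurable_continuous_onI continuous_on_vec_lambda continuous_intros)
  ultimately have "emeasure (distr lborel borel ?T) (box l u) = emeasure lborel (box (?T l) (?T u))"
    by (simp add: emeasure_distr)
  also have "\<dots> = (\<Prod>b\<in>Basis. (?T u - ?T l) \<bullet> b)"
    using le by (intro emeasure_lborel_box) (auto simp: Basis_vec_def inner_axis)
  also have "\<dots> = (\<Prod>b\<in>Basis. (u - l) \<bullet> b)"
    using prod.reindex_bij_betw[of "Transposition.transpose i j" UNIV UNIV "\<lambda>k. u $ k - l $ k"]
    by (simp add: prod_Basis_cart)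
  finally show "emeasure (distr lborel borel ?T) (box l u) = (\<Prod>b\<in>Basis. (u - l) \<bullet> b)" .
qed simp

text \<open>The reflection is a diagonal map with entries 1 and -1, and the product of their
  absolute values is the scaling factor of the measure.\<close>

lemma lborel_reflect_invariant:
  fixes i :: "'n::finite"
  shows "distr lborel borel (\<lambda>x::real^'n. \<chi> k. if k = i then - x $ k else x $ k) = lborel"
proof -
  define c :: "real^'n \<Rightarrow> real" where "c = (\<lambda>b. if b = axis i 1 then -1 else 1)"
  have "(\<Sum>b\<in>Basis. (c b * (x \<bullet> b)) *\<^sub>R b) = (\<chi> k. if k = i then - x $ k else x $ k)" for x :: "real^'n"
  proof -
    have B: "(Basis :: (real^'n) set) = (\<lambda>i. axis i 1) ` UNIV" by (auto simp: Basis_vec_def)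
    have "inj (\<lambda>i. axis i 1 :: real^'n)" by (auto simp: inj_on_def axis_eq_axis)
    then have "(\<Sum>b\<in>Basis. (c b * (x \<bullet> b)) *\<^sub>R b) = (\<Sum>k\<in>UNIV. ((if k = i then -1 else 1) * x $ k) *\<^sub>R axis k 1)"
      by (simp add: B sum.reindex cart_eq_inner_axis c_def axis_eq_axis)
    also have "\<dots> = (\<chi> k. if k = i then - x $ k else x $ k)"
      by (simp add: vec_eq_iff axis_def if_distrib cong: if_cong)
    finally show ?thesis .
  qed
  moreover have "lborel = density (distr lborel borel (\<lambda>x. 0 + (\<Sum>b\<in>Basis. (c b * (x \<bullet> b)) *\<^sub>R b)))
      (\<lambda>_. (\<Prod>b\<in>Basis. \<bar>c b\<bar>))"
    by (rule lborel_affine_euclidean) (simp add: c_def)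
  moreover have "(\<Prod>b\<in>Basis. \<bar>c b\<bar>) = 1" by (intro prod.neutral) (auto simp: c_def)
  ultimately show ?thesis by (simp add: density_1)
qed

lemma integrable_sphere_component_product:
  fixes i k :: "'n::finite"
  shows "integrable sphere_measure (\<lambda>\<zeta>::real^'n. \<zeta> $ i * \<zeta> $ k)"
proof (rule integrable_sphere_measure_bounded[where B = 1])
  show "AE \<zeta> in (sphere_measure :: (real^'n) measure). norm (\<zeta> $ i * \<zeta> $ k) \<le> 1"
  proof (rule AE_I2)
    fix \<zeta> :: "real^'n" assume "\<zeta> \<in> space sphere_measure"
    then have "\<bar>\<zeta> $ i\<bar> \<le> 1" "\<bar>\<zeta> $ k\<bar> \<le> 1" using component_le_norm_cart[of \<zeta>] by auto
    then show "norm (\<zeta> $ i * \<zeta> $ k) \<le> 1" by (simp add: abs_mult mult_le_one)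
  qed
qed (intro borel_measurable_sphere_measure borel_measurable_continuous_onI continuous_intros)

text \<open>Coordinate swaps make all diagonal moments equal, and they add up to 1 on the unit
  sphere. Reflecting one coordinate shows that an off-diagonal moment equals its negative.\<close>

lemma sphere_measure_second_moments:
  fixes i j :: "'n::finite"
  shows "integral\<^sup>L sphere_measure (\<lambda>\<zeta>::real^'n. \<zeta> $ i * \<zeta> $ j) = (if i = j then 1 / CARD('n) else 0)"
proof -
  interpret prob_space "sphere_measure :: (real^'n) measure" by (rule prob_space_sphere_measure)
  have meas[measurable]: "(\<lambda>\<zeta>::real^'n. \<zeta> $ i * \<zeta> $ j) \<in> borel_measurable borel" for i j
    by (intro borel_measurable_continuous_onI continuous_intros)
  have same: "integral\<^sup>L sphere_measure (\<lambda>\<zeta>::real^'n. \<zeta> $ k * \<zeta> $ k) = integral\<^sup>L sphere_measure (\<lambda>\<zeta>::real^'n. \<zeta> $ i * \<zeta> $ i)" for k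
  proof -
    let ?T = "\<lambda>x::real^'n. \<chi> l. x $ Transposition.transpose i k l"
    have "norm (?T x) = norm x" for x :: "real^'n"
    proof -
      have "(\<Sum>l\<in>UNIV. (norm (x $ Transposition.transpose i k l))\<^sup>2) = (\<Sum>l\<in>UNIV. (norm (x $ l))\<^sup>2)"
        by (rule sum.reindex_bij_betw) simp
      then show ?thesis by (simp add: norm_vec_def L2_set_def)
    qed
    moreover have "linear ?T" by (rule linearI) (simp_all add: vec_eq_iff)
    ultimately show ?thesis
      using sphere_measure_isometry_invariant[OF meas[of k k], of ?T] lborel_transpose_invariant[of i k]
      by simp
  qed
  show ?thesis
  proof (cases "i = j")
    case True
    have "1 = integral\<^sup>L sphere_measure (\<lambda>\<zeta>::real^'n. \<Sum>k\<in>UNIV. \<zeta> $ k * \<zeta> $ k)"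
    proof -
      have "integral\<^sup>L sphere_measure (\<lambda>\<zeta>::real^'n. \<Sum>k\<in>UNIV. \<zeta> $ k * \<zeta> $ k) = integral\<^sup>L sphere_measure (\<lambda>\<zeta>::real^'n. 1::real)"
        by (rule Bochner_Integration.integral_cong) (auto simp: norm_vec_def L2_set_def power2_eq_square)
      then show ?thesis using prob_space by simp
    qed
    also have "\<dots> = CARD('n) * integral\<^sup>L sphere_measure (\<lambda>\<zeta>::real^'n. \<zeta> $ i * \<zeta> $ i)"
    proof -
      have "integral\<^sup>L sphere_measure (\<lambda>\<zeta>::real^'n. \<Sum>k\<in>UNIV. \<zeta> $ k * \<zeta> $ k)
          = (\<Sum>k\<in>UNIV. integral\<^sup>L sphere_measure (\<lambda>\<zeta>::real^'n. \<zeta> $ k * \<zeta> $ k))"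
        by (simp add: integrable_sphere_component_product)
      also have "\<dots> = (\<Sum>k\<in>(UNIV::'n set). integral\<^sup>L sphere_measure (\<lambda>\<zeta>::real^'n. \<zeta> $ i * \<zeta> $ i))"
        by (intro sum.cong same refl)
      finally show ?thesis by simp
    qed
    finally show ?thesis using True by (simp add: field_simps)
  next
    case False
    let ?T = "\<lambda>x::real^'n. \<chi> k. if k = i then - x $ k else x $ k"
    have "norm (?T x) = norm x" for x :: "real^'n"
      by (auto simp: norm_vec_def L2_set_def intro!: arg_cong[of _ _ sqrt] sum.cong)
    moreover have "linear ?T" by (rule linearI) (simp_all add: vec_eq_iff)
    ultimately have "integral\<^sup>L sphere_measure (\<lambda>\<zeta>::real^'n. - (\<zeta> $ i * \<zeta> $ j)) = integral\<^sup>L sphere_measure (\<lambda>\<zeta>::real^'n. \<zeta> $ i * \<zeta> $ j)"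
      using sphere_measure_isometry_invariant[OF meas[of i j], of ?T] lborel_reflect_invariant[of i] False
      by simp
    then show ?thesis using False by simp
  qed
qed

section \<open>Integrals against the boundary function and its first moments\<close>

lemma sphere_integral_scaleR_bound:
  fixes \<phi> :: "real^'n \<Rightarrow> real^'n" and f :: "real^'n \<Rightarrow> real"
  assumes \<phi>: "\<phi> \<in> borel_measurable sphere_measure" "AE \<zeta> in sphere_measure. norm (\<phi> \<zeta>) \<le> M"
    and f: "f \<in> borel_measurable borel" "\<And>\<zeta>. norm \<zeta> = 1 \<Longrightarrow> \<bar>f \<zeta>\<bar> \<le> B"
  shows "integrable sphere_measure (\<lambda>\<zeta>. f \<zeta> *\<^sub>R \<phi> \<zeta>)"
    and "norm (integral\<^sup>L sphere_measure (\<lambda>\<zeta>. f \<zeta> *\<^sub>R \<phi> \<zeta>)) \<le> B * M"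
proof -
  interpret prob_space "sphere_measure :: (real^'n) measure" by (rule prob_space_sphere_measure)
  have B: "AE \<zeta> in sphere_measure. norm (f \<zeta> *\<^sub>R \<phi> \<zeta>) \<le> B * M"
    using \<phi>(2)
  proof (rule AE_mp, intro AE_I2 impI)
    fix \<zeta> :: "real^'n" assume "\<zeta> \<in> space sphere_measure" "norm (\<phi> \<zeta>) \<le> M"
    then show "norm (f \<zeta> *\<^sub>R \<phi> \<zeta>) \<le> B * M"
      using f(2)[of \<zeta>] by (simp add: mult_mono)
  qed
  show int: "integrable sphere_measure (\<lambda>\<zeta>. f \<zeta> *\<^sub>R \<phi> \<zeta>)"
    using B
    by (intro integrable_sphere_measure_bounded borel_measurable_scaleR \<phi>(1)
        borel_measurable_sphere_measure[OF f(1)])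
  have "norm (integral\<^sup>L sphere_measure (\<lambda>\<zeta>. f \<zeta> *\<^sub>R \<phi> \<zeta>))
      \<le> integral\<^sup>L sphere_measure (\<lambda>\<zeta>. norm (f \<zeta> *\<^sub>R \<phi> \<zeta>))"
    by (rule integral_norm_bound)
  also have "\<dots> \<le> B * M"
    using int B by (intro integral_le_const integrable_norm)
  finally show "norm (integral\<^sup>L sphere_measure (\<lambda>\<zeta>. f \<zeta> *\<^sub>R \<phi> \<zeta>)) \<le> B * M" .
qed

text \<open>Rows belong to the components of \<open>\<phi>\<close> and columns to the coordinates of
  \<zeta>, so that multiplication by \<open>h\<close> integrates
  \<open>(\<zeta> \<bullet> h) *\<^sub>R \<phi> \<zeta>\<close>. Up to a scalar factor this is the
  derivative of the Poisson integral at 0.\<close>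

definition moment_matrix :: "(real^'n \<Rightarrow> real^'n) \<Rightarrow> real^'n^'n" where
  "moment_matrix \<phi> = (\<chi> j i. integral\<^sup>L sphere_measure (\<lambda>\<zeta>. \<zeta> $ i * \<phi> \<zeta> $ j))"

context
  fixes \<phi> :: "real^'n \<Rightarrow> real^'n" and M :: real
  assumes phi_meas: "\<phi> \<in> borel_measurable sphere_measure"
    and phi_bound: "AE \<zeta> in sphere_measure. norm (\<phi> \<zeta>) \<le> M"
begin

lemma integrable_component_phi:
  "integrable sphere_measure (\<lambda>\<zeta>. \<zeta> $ i * \<phi> \<zeta> $ j)"
proof -
  have "integrable sphere_measure (\<lambda>\<zeta>. (\<zeta> $ i) *\<^sub>R \<phi> \<zeta>)"
  proof (rule sphere_integral_scaleR_bound(1)[OF phi_meas phi_bound])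
    show "\<bar>\<zeta> $ i\<bar> \<le> 1" if "norm \<zeta> = 1" for \<zeta> :: "real^'n"
      using component_le_norm_cart[of \<zeta> i] that by simp
  qed (intro borel_measurable_continuous_onI continuous_intros)
  from integrable_inner_left[OF this, of "axis j 1"] show ?thesis
    by (simp add: inner_axis)
qed

lemma integral_inner_scaleR_phi:
  "integral\<^sup>L sphere_measure (\<lambda>\<zeta>. (\<zeta> \<bullet> h) *\<^sub>R \<phi> \<zeta>) = moment_matrix \<phi> *v h"
proof -
  have int: "integrable sphere_measure (\<lambda>\<zeta>. (\<zeta> \<bullet> h) *\<^sub>R \<phi> \<zeta>)"
  proof (intro sphere_integral_scaleR_bound(1)[OF phi_meas phi_bound, of _ "norm h"])
    show "\<bar>\<zeta> \<bullet> h\<bar> \<le> norm h" if "norm \<zeta> = 1" for \<zeta> :: "real^'n"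
      using Cauchy_Schwarz_ineq2[of \<zeta> h] that by simp
  qed simp
  have "integral\<^sup>L sphere_measure (\<lambda>\<zeta>. (\<zeta> \<bullet> h) *\<^sub>R \<phi> \<zeta>) $ j = (moment_matrix \<phi> *v h) $ j" for j
  proof -
    have "integral\<^sup>L sphere_measure (\<lambda>\<zeta>. (\<zeta> \<bullet> h) *\<^sub>R \<phi> \<zeta>) $ j
        = integral\<^sup>L sphere_measure (\<lambda>\<zeta>. ((\<zeta> \<bullet> h) *\<^sub>R \<phi> \<zeta>) \<bullet> axis j 1)"
      using int by (subst integral_inner_left) (auto simp: inner_axis)
    also have "\<dots> = integral\<^sup>L sphere_measure (\<lambda>\<zeta>. \<Sum>i\<in>UNIV. \<zeta> $ i * \<phi> \<zeta> $ j * h $ i)"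
      by (simp add: inner_axis) (simp add: inner_vec_def sum_distrib_right sum_distrib_left mult_ac)
    also have "\<dots> = (moment_matrix \<phi> *v h) $ j"
      by (simp add: integrable_component_phi moment_matrix_def matrix_vector_mult_def)
    finally show ?thesis .
  qed
  then show ?thesis by (simp add: vec_eq_iff)
qed

text \<open>Bessel's inequality for the coordinate functions, which are orthogonal on the sphere.\<close>

lemma norm_moment_matrix_le: "(norm (moment_matrix \<phi>))\<^sup>2 \<le> M\<^sup>2 / CARD('n)"
proof -
  interpret prob_space "sphere_measure :: (real^'n) measure" by (rule prob_space_sphere_measure)
  let ?A = "moment_matrix \<phi>" and ?n = "real CARD('n)"
  note int2 = integrable_sphere_component_product
  have nA: "(norm ?A)\<^sup>2 = (\<Sum>j\<in>UNIV. \<Sum>i\<in>UNIV. (?A $ j $ i)\<^sup>2)"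
    by (simp add: norm_vec_square)
  have sq: "(norm (?A *v \<zeta>))\<^sup>2 = (\<Sum>j\<in>UNIV. \<Sum>i\<in>UNIV. \<Sum>k\<in>UNIV. ?A $ j $ i * ?A $ j $ k * (\<zeta> $ i * \<zeta> $ k))" for \<zeta>
  proof -
    have "((?A *v \<zeta>) $ j)\<^sup>2 = (\<Sum>i\<in>UNIV. \<Sum>k\<in>UNIV. ?A $ j $ i * ?A $ j $ k * (\<zeta> $ i * \<zeta> $ k))" for j
      by (simp add: matrix_vector_mult_def power2_eq_square sum_product mult_ac)
    then show ?thesis by (simp only: norm_vec_square[of "?A *v \<zeta>"] real_norm_def power2_abs)
  qed
  have "integral\<^sup>L sphere_measure (\<lambda>\<zeta>. (norm (?A *v \<zeta>))\<^sup>2)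
      = (\<Sum>j\<in>UNIV. \<Sum>i\<in>UNIV. \<Sum>k\<in>UNIV. ?A $ j $ i * ?A $ j $ k * (if i = k then 1 / ?n else 0))"
    unfolding sq by (simp add: int2 sphere_measure_second_moments)
  also have "\<dots> = (norm ?A)\<^sup>2 / ?n"
    unfolding nA by (simp add: sum_divide_distrib power2_eq_square if_distrib cong: if_cong)
  finally have i1: "integral\<^sup>L sphere_measure (\<lambda>\<zeta>. (norm (?A *v \<zeta>))\<^sup>2) = (norm ?A)\<^sup>2 / ?n" .
  have int1: "integrable sphere_measure (\<lambda>\<zeta>. (norm (?A *v \<zeta>))\<^sup>2)"
    unfolding sq by (intro Bochner_Integration.integrable_sum integrable_mult_right int2)
  have ip: "\<phi> \<zeta> \<bullet> (?A *v \<zeta>) = (\<Sum>j\<in>UNIV. \<Sum>i\<in>UNIV. ?A $ j $ i * (\<zeta> $ i * \<phi> \<zeta> $ j))" for \<zeta>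
    by (simp add: inner_vec_def matrix_vector_mult_def sum_distrib_left mult_ac)
  have int3: "integrable sphere_measure (\<lambda>\<zeta>. \<phi> \<zeta> \<bullet> (?A *v \<zeta>))"
    unfolding ip by (intro Bochner_Integration.integrable_sum integrable_mult_right integrable_component_phi)
  have "integral\<^sup>L sphere_measure (\<lambda>\<zeta>. \<phi> \<zeta> \<bullet> (?A *v \<zeta>))
      = (\<Sum>j\<in>UNIV. \<Sum>i\<in>UNIV. ?A $ j $ i * integral\<^sup>L sphere_measure (\<lambda>\<zeta>. \<zeta> $ i * \<phi> \<zeta> $ j))"
    unfolding ip by (simp add: integrable_component_phi)
  also have "\<dots> = (norm ?A)\<^sup>2"
    unfolding nA by (simp add: moment_matrix_def power2_eq_square)
  finally have "(norm ?A)\<^sup>2 = integral\<^sup>L sphere_measure (\<lambda>\<zeta>. \<phi> \<zeta> \<bullet> (?A *v \<zeta>))" by simp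
  \<comment> \<open>Young's inequality with weight n: after integration the second term is half the
    squared norm of the matrix and is absorbed on the left.\<close>
  also have "\<dots> \<le> integral\<^sup>L sphere_measure (\<lambda>\<zeta>. M\<^sup>2 / (2 * ?n) + ?n / 2 * (norm (?A *v \<zeta>))\<^sup>2)"
  proof (rule integral_mono_AE)
    show "AE \<zeta> in sphere_measure. \<phi> \<zeta> \<bullet> (?A *v \<zeta>) \<le> M\<^sup>2 / (2 * ?n) + ?n / 2 * (norm (?A *v \<zeta>))\<^sup>2"
      using phi_bound
    proof eventually_elim
      fix \<zeta> assume le: "norm (\<phi> \<zeta>) \<le> M"
      define b where "b = norm (?A *v \<zeta>)"
      have "\<phi> \<zeta> \<bullet> (?A *v \<zeta>) \<le> norm (\<phi> \<zeta>) * b" unfolding b_def by (rule norm_cauchy_schwarz)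
      also have "\<dots> \<le> M * b" using le by (intro mult_right_mono) (auto simp: b_def)
      also have "\<dots> \<le> M\<^sup>2 / (2 * ?n) + ?n / 2 * b\<^sup>2"
      proof -
        have "0 \<le> (M - ?n * b)\<^sup>2 / (2 * ?n)" by simp
        also have "\<dots> = M\<^sup>2 / (2 * ?n) + ?n / 2 * b\<^sup>2 - M * b"
          by (simp add: power2_eq_square field_simps)
        finally show ?thesis by simp
      qed
      finally show "\<phi> \<zeta> \<bullet> (?A *v \<zeta>) \<le> M\<^sup>2 / (2 * ?n) + ?n / 2 * (norm (?A *v \<zeta>))\<^sup>2"
        by (simp add: b_def)
    qed
  qed (use int1 int3 in auto)
  also have "\<dots> = M\<^sup>2 / (2 * ?n) + ?n / 2 * ((norm ?A)\<^sup>2 / ?n)"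
    using int1 prob_space by (simp add: i1)
  finally show ?thesis by (simp add: field_simps)
qed

end

section \<open>The kernel near the origin\<close>

text \<open>Used with p = s + 2. From ln (1 - t) \<ge> - t / (1 - t) the power (1 - t)^p is at least
  1 - y with y = p t / (1 - t), and y is at most 1/6.\<close>

lemma powr_minus_one_minus_le:
  fixes p t :: real
  assumes "p \<ge> 4" "0 \<le> t" "t * (p + 1) \<le> 1 / 6"
  shows "(1 - t) powr (- p) \<le> 1 + 5 / 4 * (p * t)" "(1 - t) powr (- p) \<le> 5 / 4"
proof -
  have t5: "t * 5 \<le> t * (p + 1)" using assms by (intro mult_left_mono) auto
  then have t: "t \<le> 1 / 30" using assms by linarith
  define y where "y = p * t / (1 - t)"
  have y: "0 \<le> y" "y \<le> 1 / 6"
    using assms t by (auto simp: y_def field_simps)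
  have "ln (1 - t) \<ge> - (t / (1 - t))"
    using ln_add_one_self_le_self[of "t / (1 - t)"] t assms
      ln_divide_pos[of 1 "1 - t"]
    by (simp add: field_simps)
  then have "p * - (t / (1 - t)) \<le> p * ln (1 - t)"
    using assms(1) by (intro mult_left_mono) auto
  then have "- y \<le> p * ln (1 - t)"
    by (simp add: y_def)
  moreover have "1 - y \<le> exp (- y)" using exp_ge_add_one_self[of "- y"] by simp
  ultimately have "1 - y \<le> exp (p * ln (1 - t))"
    by (meson exp_le_cancel_iff order_trans)
  also have "\<dots> = (1 - t) powr p" using t by (simp add: powr_def)
  finally have "inverse ((1 - t) powr p) \<le> inverse (1 - y)"
    using y by (intro le_imp_inverse_le) auto
  \<comment> \<open>The factor 6/5 is 1 / (1 - y) at y = 1/6.\<close>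
  also have "\<dots> \<le> 1 + 6 / 5 * y"
  proof -
    have "y * y \<le> y * (1 / 6)" using y by (intro mult_left_mono) auto
    then show ?thesis using y by (simp add: field_simps)
  qed
  finally have E: "(1 - t) powr (- p) \<le> 1 + 6 / 5 * y" by (simp add: powr_minus)
  then show "(1 - t) powr (- p) \<le> 5 / 4" using y by linarith
  \<comment> \<open>Here t \<le> 1/30 enters; the two factors multiply to 36/29, which is below
    5/4.\<close>
  have "y \<le> 30 / 29 * (p * t)"
  proof -
    have "t * (p * t) \<le> 1 / 30 * (p * t)" using t assms by (intro mult_right_mono) auto
    then show ?thesis using t assms unfolding y_def by (simp add: field_simps)
  qed
  moreover have "p * t \<ge> 0" using assms by simp
  ultimately show "(1 - t) powr (- p) \<le> 1 + 5 / 4 * (p * t)" using E by linarith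
qed

text \<open>The kernel without its constant, for a = 1 - \<alpha> and s = n - \<alpha>. Inner
  products replace norms to ease differentiation; since the second base is a squared distance, the
  exponent s is halved.\<close>

definition poisson_quotient :: "real \<Rightarrow> real \<Rightarrow> 'a::euclidean_space \<Rightarrow> 'a \<Rightarrow> real" where
  "poisson_quotient a s \<zeta> x = (1 - x \<bullet> x) powr a * ((x - \<zeta>) \<bullet> (x - \<zeta>)) powr (- s / 2)"

text \<open>The differential in the direction \<open>h\<close>. At x = 0, for a unit vector \<zeta>,
  it is \<open>s * (\<zeta> \<bullet> h)\<close>, the linear part subtracted in the estimates
  below.\<close>

definition poisson_quotient' :: "real \<Rightarrow> real \<Rightarrow> 'a::euclidean_space \<Rightarrow> 'a \<Rightarrow> 'a \<Rightarrow> real" where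
  "poisson_quotient' a s \<zeta> x h =
     - 2 * a * (1 - x \<bullet> x) powr (a - 1) * ((x - \<zeta>) \<bullet> (x - \<zeta>)) powr (- s / 2) * (x \<bullet> h)
     - s * (1 - x \<bullet> x) powr a * ((x - \<zeta>) \<bullet> (x - \<zeta>)) powr (- s / 2 - 1) * ((x - \<zeta>) \<bullet> h)"

lemma has_derivative_poisson_quotient:
  fixes x \<zeta> :: "'a::euclidean_space"
  assumes "norm x < 1" "norm \<zeta> = 1"
  shows "(poisson_quotient a s \<zeta> has_derivative poisson_quotient' a s \<zeta> x) (at x)"
proof -
  have pos: "1 - x \<bullet> x > 0" using assms(1) by (simp add: dot_square_norm power_less_one_iff abs_square_less_1)
  have pos': "(x - \<zeta>) \<bullet> (x - \<zeta>) > 0" using assms by auto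
  have d1: "((\<lambda>x. 1 - x \<bullet> x) has_derivative (\<lambda>h. - 2 * (x \<bullet> h))) (at x)"
    by (auto intro!: derivative_eq_intros simp: inner_commute)
  have d2: "((\<lambda>x. (x - \<zeta>) \<bullet> (x - \<zeta>)) has_derivative (\<lambda>h. 2 * ((x - \<zeta>) \<bullet> h))) (at x)"
    by (auto intro!: derivative_eq_intros simp: inner_commute)
  have "((\<lambda>x. (1 - x \<bullet> x) powr a) has_derivative (\<lambda>h. - 2 * a * (1 - x \<bullet> x) powr (a - 1) * (x \<bullet> h))) (at x)"
    using has_derivative_powr[OF d1 has_derivative_const[of a] pos UNIV_I] pos
    by (simp add: powr_diff mult_ac)
  moreover have "((\<lambda>x. ((x - \<zeta>) \<bullet> (x - \<zeta>)) powr (- s / 2))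
      has_derivative (\<lambda>h. - s * ((x - \<zeta>) \<bullet> (x - \<zeta>)) powr (- s / 2 - 1) * ((x - \<zeta>) \<bullet> h))) (at x)"
    using has_derivative_powr[OF d2 has_derivative_const[of "- s / 2"] pos' UNIV_I] pos'
    by (simp add: powr_diff mult_ac)
  ultimately show ?thesis
    unfolding poisson_quotient_def[abs_def]
    by (rule has_derivative_eq_rhs[OF has_derivative_mult])
      (simp add: poisson_quotient'_def fun_eq_iff algebra_simps)
qed

text \<open>The difference splits into three terms with power factors \<open>A\<close>,
  \<open>B\<close> and \<open>B - 1\<close>. With E = (1 - |x|)^(-(s + 2)), both \<open>A\<close>
  and \<open>B\<close> are at most \<open>E\<close>, and \<open>B\<close> differs from 1 by at most
  \<open>E - 1\<close>. The smallness of x then makes these bounds 5/4 and 5/4 (s + 2) |x|, which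
  yields the summands 2 a, s and s (s + 2).\<close>

lemma poisson_quotient'_bound:
  fixes x \<zeta> h :: "'a::euclidean_space"
  assumes "norm \<zeta> = 1" and a: "a > 0" and s: "s \<ge> 2" "s \<ge> a" and x: "norm x * (s + 3) \<le> 1 / 6"
  shows "\<bar>poisson_quotient' a s \<zeta> x h - s * (\<zeta> \<bullet> h)\<bar>
    \<le> 5 / 4 * norm x * (2 * a + s + s * (s + 2)) * norm h"
proof -
  define t where "t = norm x"
  define D where "D = norm (x - \<zeta>)"
  define E where "E = (1 - t) powr (- (s + 2))"
  have t0: "t \<ge> 0" and t3: "t * (s + 2 + 1) \<le> 1 / 6" using x by (auto simp: t_def add.commute)
  have "t * 5 \<le> t * (s + 2 + 1)" using s t0 by (intro mult_left_mono) auto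
  then have t1: "t \<le> 1 / 30" using t3 by linarith
  have E: "E \<le> 1 + 5 / 4 * ((s + 2) * t)" "E \<le> 5 / 4"
    using powr_minus_one_minus_le[of "s + 2" t] s t0 t3 by (auto simp: E_def)
  have E1: "E \<ge> 1"
    using s t0 t1 powr_mono2'[of "- (s + 2)" "1 - t" 1] by (simp add: E_def)
  have D: "1 - t \<le> D" "D \<le> 1 + t"
    using norm_triangle_ineq2[of \<zeta> x] norm_triangle_ineq4[of x \<zeta>] assms(1)
    by (auto simp: D_def t_def norm_minus_commute)
  then have Dpos: "D > 0" using t1 by linarith
  have tt: "t * t \<le> t" "t * t \<ge> 0" using t0 t1 by (auto intro: mult_left_le_one_le)
  have xx: "1 - x \<bullet> x = 1 - t\<^sup>2" by (simp add: t_def dot_square_norm)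
  have u: "1 - t \<le> 1 - t\<^sup>2" "1 - t\<^sup>2 \<le> 1" "1 - t\<^sup>2 = (1 - t) * (1 + t)"
    using tt by (auto simp: power2_eq_square algebra_simps)
  have Dp: "((x - \<zeta>) \<bullet> (x - \<zeta>)) powr q = D powr (2 * q)" for q
    using Dpos by (simp add: D_def dot_square_norm powr_powr[symmetric] powr_numeral)
  define A where "A = (1 - t\<^sup>2) powr (a - 1) * D powr (- s)"
  define B where "B = (1 - t\<^sup>2) powr a * D powr (- (s + 2))"
  have Dneg: "D powr (- q) \<le> (1 - t) powr (- q)" if "q \<ge> 0" for q
    using that D t1 by (intro powr_mono2') auto
  have A: "0 \<le> A" "A \<le> E"
  proof -
    \<comment> \<open>The exponent -2 is what completes (1 - t)^(-s) to \<open>E\<close>. The sign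
      of a - 1 decides which monotonicity of the power applies.\<close>
    have "(1 - t\<^sup>2) powr (a - 1) \<le> (1 - t) powr (- 2)"
    proof (cases "a \<ge> 1")
      case True
      then have "(1 - t\<^sup>2) powr (a - 1) \<le> 1" using u t1 by (intro powr_le1) auto
      also have "1 \<le> (1 - t) powr (- 2)"
        using t0 t1 powr_mono2'[of "- 2" "1 - t" 1] by simp
      finally show ?thesis .
    next
      case False
      have "(1 - t\<^sup>2) powr (a - 1) \<le> (1 - t) powr (a - 1)"
        using False u t1 by (intro powr_mono2') auto
      also have "\<dots> \<le> (1 - t) powr (- 2)" using a t0 t1 by (intro powr_mono') auto
      finally show ?thesis .
    qed
    then have "A \<le> (1 - t) powr (- 2) * (1 - t) powr (- s)"
      unfolding A_def using Dneg[of s] s by (intro mult_mono) auto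
    also have "\<dots> = E" using t1 by (simp add: E_def powr_add[symmetric] add.commute)
    finally show "A \<le> E" .
  qed (simp add: A_def)
  have BE: "B \<le> E"
  proof -
    have "B \<le> 1 * (1 - t) powr (- (s + 2))"
      unfolding B_def using Dneg[of "s + 2"] s u a t1 by (intro mult_mono powr_le1) auto
    then show ?thesis by (simp add: E_def)
  qed
  have B0: "0 \<le> B" by (simp add: B_def)
  have Blow: "B \<ge> (1 - t) powr (s + 2)"
  proof -
    \<comment> \<open>The exponent is split so that (1 - t)^a can later be joined with (1 + t)^a to
      a power of 1 - t^2; the rest, whose exponent s + 2 - a is positive, is compared through 1 - t
      \<le> 1 / (1 + t).\<close>
    have "(1 - t) powr (s + 2) \<le> (1 - t) powr a * (1 - t) powr (s + 2 - a)"
      using t1 by (simp add: powr_add[symmetric])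
    also have "\<dots> \<le> (1 - t) powr a * (1 + t) powr (- (s + 2 - a))"
    proof (intro mult_left_mono)
      have "1 - t \<le> inverse (1 + t)"
      proof -
        have "1 + t > 0" using t0 by linarith
        moreover have "(1 - t) * (1 + t) \<le> 1" using tt by (simp add: algebra_simps)
        ultimately show ?thesis
          unfolding inverse_eq_divide by (rule mult_imp_le_div_pos)
      qed
      then have "(1 - t) powr (s + 2 - a) \<le> inverse (1 + t) powr (s + 2 - a)"
        using s t1 by (intro powr_mono2) auto
      also have "\<dots> = (1 + t) powr (- (s + 2 - a))"
        using t0 by (simp only: powr_minus inverse_powr add_nonneg_nonneg zero_le_one)
      finally show "(1 - t) powr (s + 2 - a) \<le> (1 + t) powr (- (s + 2 - a))" .
    qed simp
    also have "\<dots> = (1 - t\<^sup>2) powr a * (1 + t) powr (- (s + 2))"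
    proof -
      have "(1 + t) powr (- (s + 2 - a)) = (1 + t) powr a * (1 + t) powr (- (s + 2))"
        unfolding powr_add[symmetric] by (rule arg_cong[where f = "(powr) (1 + t)"]) simp
      then show ?thesis using t0 t1 by (simp add: u(3) powr_mult)
    qed
    also have "\<dots> \<le> B"
      unfolding B_def using D Dpos s by (intro mult_left_mono powr_mono2') auto
    finally show ?thesis .
  qed
  have B1: "\<bar>B - 1\<bar> \<le> E - 1"
  proof -
    \<comment> \<open>Since \<open>E\<close> is the reciprocal of this power \<open>w\<close>, the
      claim is w + 1 / w \<ge> 2: the drop below 1 is no larger than the rise above it.\<close>
    have "1 - (1 - t) powr (s + 2) \<le> E - 1"
    proof -
      define w where "w = (1 - t) powr (s + 2)"
      have w: "w > 0" "E = 1 / w"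
        using t1 powr_minus_divide[of "1 - t" "s + 2"] by (auto simp: w_def E_def)
      have "(w - 1) * (w - 1) \<ge> 0" by simp
      then have "2 * w \<le> 1 + w * w" by (simp add: algebra_simps)
      then have "2 \<le> 1 / w + w" using w by (simp add: field_simps)
      then show ?thesis using w by (simp add: w_def)
    qed
    then show ?thesis using Blow BE by linarith
  qed
  have eq: "poisson_quotient' a s \<zeta> x h - s * (\<zeta> \<bullet> h)
      = - (2 * a * A * (x \<bullet> h)) - s * B * (x \<bullet> h) + s * (B - 1) * (\<zeta> \<bullet> h)"
    unfolding poisson_quotient'_def xx Dp A_def B_def by (simp add: algebra_simps inner_diff_left)
  have xh: "\<bar>x \<bullet> h\<bar> \<le> t * norm h" and zh: "\<bar>\<zeta> \<bullet> h\<bar> \<le> norm h"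
    using Cauchy_Schwarz_ineq2[of x h] Cauchy_Schwarz_ineq2[of \<zeta> h] assms(1) by (auto simp: t_def)
  have "\<bar>2 * a * A * (x \<bullet> h)\<bar> \<le> 2 * a * (5 / 4) * (t * norm h)"
    unfolding abs_mult using a A E(2) xh by (intro mult_mono) auto
  moreover have "\<bar>s * B * (x \<bullet> h)\<bar> \<le> s * (5 / 4) * (t * norm h)"
    unfolding abs_mult using s B0 BE E(2) xh by (intro mult_mono) auto
  moreover have "\<bar>s * (B - 1) * (\<zeta> \<bullet> h)\<bar> \<le> s * (5 / 4 * ((s + 2) * t)) * norm h"
    unfolding abs_mult using s B1 E zh t0 by (intro mult_mono) auto
  ultimately have "\<bar>poisson_quotient' a s \<zeta> x h - s * (\<zeta> \<bullet> h)\<bar>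
      \<le> 2 * a * (5 / 4) * (t * norm h) + s * (5 / 4) * (t * norm h) + s * (5 / 4 * ((s + 2) * t)) * norm h"
    unfolding eq by linarith
  also have "\<dots> = 5 / 4 * norm x * (2 * a + s + s * (s + 2)) * norm h"
    by (simp add: t_def algebra_simps)
  finally show ?thesis .
qed

text \<open>Mean value inequality on the closed ball of radius \<rho>, for the quotient minus its
  linear part at 0.\<close>

lemma poisson_quotient_increment:
  fixes x y \<zeta> :: "'a::euclidean_space"
  assumes \<zeta>: "norm \<zeta> = 1" and a: "a > 0" and s: "s \<ge> 2" "s \<ge> a" and \<rho>: "\<rho> * (s + 3) \<le> 1 / 6"
    and xy: "norm x \<le> \<rho>" "norm y \<le> \<rho>"
  shows "\<bar>poisson_quotient a s \<zeta> x - poisson_quotient a s \<zeta> y - s * (\<zeta> \<bullet> (x - y))\<bar>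
    \<le> 5 / 4 * \<rho> * (2 * a + s + s * (s + 2)) * norm (x - y)"
proof -
  let ?f = "\<lambda>x. poisson_quotient a s \<zeta> x - s * (\<zeta> \<bullet> x)"
  let ?f' = "\<lambda>x h. poisson_quotient' a s \<zeta> x h - s * (\<zeta> \<bullet> h)"
  let ?c = "2 * a + s + s * (s + 2)"
  have \<rho>0: "\<rho> \<ge> 0" using xy norm_ge_zero order_trans by blast
  have "\<rho> * 5 \<le> \<rho> * (s + 3)" using s \<rho>0 by (intro mult_left_mono) auto
  then have \<rho>1: "\<rho> < 1" using \<rho> by linarith
  have c: "?c \<ge> 0" using a s by auto
  have "norm (?f x - ?f y) \<le> 5 / 4 * \<rho> * ?c * norm (x - y)"
  proof (rule differentiable_bound[of "cball 0 \<rho>"])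
    fix z :: 'a assume "z \<in> cball 0 \<rho>"
    then have z: "norm z \<le> \<rho>" by simp
    show "(?f has_derivative ?f' z) (at z within cball 0 \<rho>)"
      using z \<rho>1 \<zeta>
      by (auto intro!: derivative_eq_intros
          has_derivative_at_withinI[OF has_derivative_poisson_quotient])
    show "onorm (?f' z) \<le> 5 / 4 * \<rho> * ?c"
    proof (rule onorm_le)
      fix h
      have "norm z * (s + 3) \<le> \<rho> * (s + 3)" using z s by (intro mult_right_mono) auto
      then have "\<bar>?f' z h\<bar> \<le> 5 / 4 * norm z * ?c * norm h"
        using poisson_quotient'_bound[OF \<zeta> a s, of z h] \<rho> by linarith
      also have "\<dots> \<le> 5 / 4 * \<rho> * ?c * norm h"
        using z c by (intro mult_right_mono mult_left_mono) auto
      finally show "norm (?f' z h) \<le> 5 / 4 * \<rho> * ?c * norm h" by simp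
    qed
  qed (use xy in auto)
  then show ?thesis by (simp add: algebra_simps inner_diff_right)
qed

text \<open>Along the segment from 0 to x the derivative bound grows linearly, so integrating it
  gives half of what the increment bound with y = 0 gives. The covering radius needs this
  half.\<close>

lemma poisson_quotient_remainder:
  fixes x \<zeta> :: "'a::euclidean_space"
  assumes \<zeta>: "norm \<zeta> = 1" and a: "a > 0" and s: "s \<ge> 2" "s \<ge> a" and x: "norm x * (s + 3) \<le> 1 / 6"
  shows "\<bar>poisson_quotient a s \<zeta> x - poisson_quotient a s \<zeta> 0 - s * (\<zeta> \<bullet> x)\<bar>
    \<le> 5 / 8 * (norm x)\<^sup>2 * (2 * a + s + s * (s + 2))"
proof -
  let ?f = "\<lambda>\<tau>. poisson_quotient a s \<zeta> (\<tau> *\<^sub>R x) - s * (\<zeta> \<bullet> (\<tau> *\<^sub>R x))"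
  let ?f' = "\<lambda>\<tau>. poisson_quotient' a s \<zeta> (\<tau> *\<^sub>R x) x - s * (\<zeta> \<bullet> x)"
  let ?c = "2 * a + s + s * (s + 2)"
  let ?\<phi> = "\<lambda>\<tau>. 5 / 8 * \<tau>\<^sup>2 * (norm x)\<^sup>2 * ?c"
  have "norm x * 5 \<le> norm x * (s + 3)" using s by (intro mult_left_mono) auto
  then have x1: "norm x < 1" using x by linarith
  have d: "(?f has_vector_derivative ?f' \<tau>) (at \<tau>)" if "0 \<le> \<tau>" "\<tau> \<le> 1" for \<tau>
  proof -
    have "norm (\<tau> *\<^sub>R x) < 1" using that x1 mult_left_le_one_le[of "norm x" "\<bar>\<tau>\<bar>"] by simp
    then have D: "(poisson_quotient a s \<zeta> has_derivative poisson_quotient' a s \<zeta> (\<tau> *\<^sub>R x)) (at (\<tau> *\<^sub>R x))"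
      using \<zeta> by (rule has_derivative_poisson_quotient)
    have "((\<lambda>\<tau>. poisson_quotient a s \<zeta> (\<tau> *\<^sub>R x)) has_vector_derivative poisson_quotient' a s \<zeta> (\<tau> *\<^sub>R x) x) (at \<tau>)"
    proof -
      have "((\<lambda>\<tau>. \<tau> *\<^sub>R x) has_vector_derivative x) (at \<tau>)"
        using has_vector_derivative_scaleR[OF DERIV_ident has_vector_derivative_const[of x]] by simp
      from vector_derivative_diff_chain_within[OF this has_derivative_at_withinI[OF D]]
      show ?thesis by (simp add: o_def)
    qed
    moreover have "((\<lambda>\<tau>. s * (\<zeta> \<bullet> (\<tau> *\<^sub>R x))) has_vector_derivative s * (\<zeta> \<bullet> x)) (at \<tau>)"
      unfolding has_real_derivative_iff_has_vector_derivative[symmetric] inner_scaleR_right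
      by (auto intro!: derivative_eq_intros)
    ultimately show ?thesis by (rule has_vector_derivative_diff)
  qed
  have "norm (?f 1 - ?f 0) \<le> ?\<phi> 1 - ?\<phi> 0"
  proof (rule differentiable_bound_general[of 0 1 ?f ?\<phi> ?f' "\<lambda>\<tau>. 5 / 4 * \<tau> * (norm x)\<^sup>2 * ?c"])
    show "(0::real) < 1" by simp
    show "continuous_on {0..1} ?f"
      by (intro continuous_at_imp_continuous_on ballI has_vector_derivative_continuous[OF d]) auto
    show "continuous_on {0..1} ?\<phi>" by (intro continuous_intros)
    fix \<tau> :: real assume \<tau>: "0 < \<tau>" "\<tau> < 1"
    then show "(?f has_vector_derivative ?f' \<tau>) (at \<tau>)" by (intro d) auto
    show "(?\<phi> has_vector_derivative 5 / 4 * \<tau> * (norm x)\<^sup>2 * ?c) (at \<tau>)"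
      unfolding has_real_derivative_iff_has_vector_derivative[symmetric]
      by (auto intro!: derivative_eq_intros)
    have "norm (\<tau> *\<^sub>R x) * (s + 3) \<le> norm x * (s + 3)"
      using \<tau> s by (intro mult_right_mono) (auto intro: mult_left_le_one_le)
    then have "\<bar>?f' \<tau>\<bar> \<le> 5 / 4 * norm (\<tau> *\<^sub>R x) * ?c * norm x"
      using x by (intro poisson_quotient'_bound[OF \<zeta> a s]) auto
    then show "norm (?f' \<tau>) \<le> 5 / 4 * \<tau> * (norm x)\<^sup>2 * ?c"
      using \<tau> by (simp add: power2_eq_square mult_ac)
  qed
  then show ?thesis by (simp add: algebra_simps)
qed

section \<open>The Poisson integral near the origin\<close>

lemma C_const_pos:
  assumes "n \<ge> 1" "\<alpha> < 1"
  shows "C_const n \<alpha> > 0"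
  using assms unfolding C_const_def
  by (intro divide_pos_pos mult_pos_pos Gamma_real_pos) auto

lemma P_kernel_eq:
  fixes x \<zeta> :: "real^'n"
  assumes "norm x < 1" "norm \<zeta> = 1"
  shows "P_kernel \<alpha> x \<zeta> = C_const CARD('n) \<alpha> * poisson_quotient (1 - \<alpha>) (real CARD('n) - \<alpha>) \<zeta> x"
proof -
  have "norm (x - \<zeta>) > 0" using assms by auto
  then have "((x - \<zeta>) \<bullet> (x - \<zeta>)) powr (- (real CARD('n) - \<alpha>) / 2)
      = norm (x - \<zeta>) powr (2 * (- (real CARD('n) - \<alpha>) / 2))"
    by (simp only: dot_square_norm powr_powr[symmetric] powr_numeral)
  also have "\<dots> = 1 / norm (x - \<zeta>) powr (real CARD('n) - \<alpha>)"
  proof -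
    have "2 * (- (real CARD('n) - \<alpha>) / 2) = - (real CARD('n) - \<alpha>)" by simp
    then show ?thesis by (simp only: powr_minus_divide)
  qed
  finally show ?thesis
    by (simp add: P_kernel_def poisson_quotient_def dot_square_norm)
qed

lemma borel_measurable_poisson_quotient [measurable]:
  "(\<lambda>\<zeta>. poisson_quotient a s \<zeta> x) \<in> borel_measurable borel"
  unfolding poisson_quotient_def by measurable

text \<open>The abbreviations are parameters with defining equations, so that the final proof can
  interpret the locale with its own constants. \<open>C * c\<close> governs the second-order terms
  near 0 and is also the lower bound for \<open>G_fun\<close> in \<open>G_fun_ge\<close>.\<close>

locale bounded_poisson =
  fixes \<phi> :: "real^'n \<Rightarrow> real^'n" and \<alpha> M a s C c :: real and D :: "real^'n^'n"
  assumes n3: "CARD('n) \<ge> 3" and alpha: "\<alpha> < 1" and Mpos: "M > 0"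
    and phi_meas: "\<phi> \<in> borel_measurable sphere_measure"
    and phi_bound: "AE \<zeta> in sphere_measure. norm (\<phi> \<zeta>) \<le> M"
    and a_def: "a = 1 - \<alpha>" and s_def: "s = real CARD('n) - \<alpha>" and C_def: "C = C_const CARD('n) \<alpha>"
    and c_def: "c = 2 * a + s + s * (s + 2)" and D_def: "D = (s * C) *\<^sub>R moment_matrix \<phi>"
begin

lemma a_pos: "a > 0" and s_ge: "s \<ge> 2" "s \<ge> a" and C_pos: "C > 0" and c_pos: "c > 0"
proof -
  show "a > 0" "s \<ge> 2" "s \<ge> a" using alpha n3 by (auto simp: a_def s_def)
  then show "c > 0" by (simp add: c_def add_nonneg_pos add_pos_nonneg)
  show "C > 0" using C_const_pos alpha n3 by (simp add: C_def)
qed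

lemma P_integral_eq:
  assumes "norm x < 1"
  shows "P_integral \<alpha> \<phi> x = integral\<^sup>L sphere_measure (\<lambda>\<zeta>. (C * poisson_quotient a s \<zeta> x) *\<^sub>R \<phi> \<zeta>)"
  unfolding P_integral_def using assms
  by (intro Bochner_Integration.integral_cong) (auto simp: P_kernel_eq a_def s_def C_def)

lemma norm_less_one:
  assumes "norm (x :: real^'n) * (s + 3) \<le> 1 / 6"
  shows "norm x < 1"
proof -
  have "norm x * 5 \<le> norm x * (s + 3)" using s_ge by (intro mult_left_mono) auto
  then show ?thesis using assms by linarith
qed

lemma integrable_poisson_quotient:
  assumes "norm x * (s + 3) \<le> 1 / 6"
  shows "integrable sphere_measure (\<lambda>\<zeta>. (C * poisson_quotient a s \<zeta> x) *\<^sub>R \<phi> \<zeta>)"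
proof (rule sphere_integral_scaleR_bound(1)[OF phi_meas phi_bound])
  fix \<zeta> :: "real^'n" assume \<zeta>: "norm \<zeta> = 1"
  have "poisson_quotient a s \<zeta> 0 = 1" using \<zeta> by (simp add: poisson_quotient_def dot_square_norm)
  moreover have "\<bar>\<zeta> \<bullet> x\<bar> \<le> norm x" using Cauchy_Schwarz_ineq2[of \<zeta> x] \<zeta> by simp
  then have "\<bar>s * (\<zeta> \<bullet> x)\<bar> \<le> s * norm x" unfolding abs_mult using s_ge by (intro mult_mono) auto
  ultimately have "\<bar>poisson_quotient a s \<zeta> x\<bar> \<le> 1 + s * norm x + 5 / 8 * (norm x)\<^sup>2 * c"
    using poisson_quotient_remainder[OF \<zeta> a_pos s_ge assms, folded c_def] by linarith
  then show "\<bar>C * poisson_quotient a s \<zeta> x\<bar> \<le> C * (1 + s * norm x + 5 / 8 * (norm x)\<^sup>2 * c)"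
    using C_pos by (simp add: abs_mult)
qed simp

text \<open>Moves the linear part under the integral sign, so that the pointwise estimates of the
  quotient carry over to \<open>P_integral\<close>.\<close>

lemma P_integral_diff:
  assumes x: "norm x * (s + 3) \<le> 1 / 6" and y: "norm y * (s + 3) \<le> 1 / 6"
  shows "P_integral \<alpha> \<phi> x - P_integral \<alpha> \<phi> y - D *v (x - y)
    = integral\<^sup>L sphere_measure (\<lambda>\<zeta>. (C * (poisson_quotient a s \<zeta> x - poisson_quotient a s \<zeta> y - s * (\<zeta> \<bullet> (x - y)))) *\<^sub>R \<phi> \<zeta>)"
proof -
  have "integrable sphere_measure (\<lambda>\<zeta>. (s * C * (\<zeta> \<bullet> (x - y))) *\<^sub>R \<phi> \<zeta>)"
  proof (rule sphere_integral_scaleR_bound(1)[OF phi_meas phi_bound])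
    fix \<zeta> :: "real^'n" assume "norm \<zeta> = 1"
    then show "\<bar>s * C * (\<zeta> \<bullet> (x - y))\<bar> \<le> s * C * norm (x - y)"
      unfolding abs_mult using Cauchy_Schwarz_ineq2[of \<zeta> "x - y"] s_ge C_pos by (intro mult_mono) auto
  qed simp
  moreover have "integral\<^sup>L sphere_measure (\<lambda>\<zeta>. (s * C * (\<zeta> \<bullet> (x - y))) *\<^sub>R \<phi> \<zeta>) = D *v (x - y)"
  proof -
    have "integral\<^sup>L sphere_measure (\<lambda>\<zeta>. (s * C * (\<zeta> \<bullet> (x - y))) *\<^sub>R \<phi> \<zeta>)
        = integral\<^sup>L sphere_measure (\<lambda>\<zeta>. (s * C) *\<^sub>R ((\<zeta> \<bullet> (x - y)) *\<^sub>R \<phi> \<zeta>))" by simp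
    also have "\<dots> = (s * C) *\<^sub>R (moment_matrix \<phi> *v (x - y))"
      by (subst integral_scaleR_right) (simp add: integral_inner_scaleR_phi[OF phi_meas phi_bound])
    finally show ?thesis by (simp add: D_def scaleR_matrix_vector_assoc)
  qed
  moreover have "(C * (poisson_quotient a s \<zeta> x - poisson_quotient a s \<zeta> y - s * (\<zeta> \<bullet> (x - y)))) *\<^sub>R \<phi> \<zeta>
      = (C * poisson_quotient a s \<zeta> x) *\<^sub>R \<phi> \<zeta> - (C * poisson_quotient a s \<zeta> y) *\<^sub>R \<phi> \<zeta>
        - (s * C * (\<zeta> \<bullet> (x - y))) *\<^sub>R \<phi> \<zeta>" for \<zeta>
    unfolding scaleR_diff_left[symmetric] by (rule arg_cong[where f = "\<lambda>z. z *\<^sub>R \<phi> \<zeta>"]) (simp add: right_diff_distrib)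
  ultimately show ?thesis
    using integrable_poisson_quotient[OF x] integrable_poisson_quotient[OF y]
    by (simp only: P_integral_eq norm_less_one[OF x] norm_less_one[OF y]
        Bochner_Integration.integral_diff Bochner_Integration.integrable_diff)
qed

lemma P_integral_increment:
  assumes "\<rho> * (s + 3) \<le> 1 / 6" "norm x \<le> \<rho>" "norm y \<le> \<rho>"
  shows "norm (P_integral \<alpha> \<phi> x - P_integral \<alpha> \<phi> y - D *v (x - y)) \<le> 5 / 4 * \<rho> * (C * c) * M * norm (x - y)"
proof -
  have le: "norm z * (s + 3) \<le> 1 / 6" if "norm z \<le> \<rho>" for z :: "real^'n"
  proof -
    have "norm z * (s + 3) \<le> \<rho> * (s + 3)" using s_ge that by (intro mult_right_mono) auto
    then show ?thesis using assms(1) by linarith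
  qed
  have "norm (P_integral \<alpha> \<phi> x - P_integral \<alpha> \<phi> y - D *v (x - y)) \<le> C * (5 / 4 * \<rho> * c * norm (x - y)) * M"
    unfolding P_integral_diff[OF le[OF assms(2)] le[OF assms(3)]]
  proof (rule sphere_integral_scaleR_bound(2)[OF phi_meas phi_bound])
    fix \<zeta> :: "real^'n" assume "norm \<zeta> = 1"
    from poisson_quotient_increment[OF this a_pos s_ge assms, folded c_def]
    show "\<bar>C * (poisson_quotient a s \<zeta> x - poisson_quotient a s \<zeta> y - s * (\<zeta> \<bullet> (x - y)))\<bar>
        \<le> C * (5 / 4 * \<rho> * c * norm (x - y))"
      unfolding abs_mult using C_pos by (intro mult_mono) auto
  qed simp
  then show ?thesis by (simp only: mult_ac)
qed

lemma P_integral_remainder: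
  assumes "norm x * (s + 3) \<le> 1 / 6"
  shows "norm (P_integral \<alpha> \<phi> x - P_integral \<alpha> \<phi> 0 - D *v x) \<le> 5 / 8 * (norm x)\<^sup>2 * (C * c) * M"
proof -
  have 0: "norm (0 :: real^'n) * (s + 3) \<le> 1 / 6" by simp
  have "norm (P_integral \<alpha> \<phi> x - P_integral \<alpha> \<phi> 0 - D *v (x - 0)) \<le> C * (5 / 8 * (norm x)\<^sup>2 * c) * M"
    unfolding P_integral_diff[OF assms 0]
  proof (rule sphere_integral_scaleR_bound(2)[OF phi_meas phi_bound])
    fix \<zeta> :: "real^'n" assume "norm \<zeta> = 1"
    from poisson_quotient_remainder[OF this a_pos s_ge assms, folded c_def]
    show "\<bar>C * (poisson_quotient a s \<zeta> x - poisson_quotient a s \<zeta> 0 - s * (\<zeta> \<bullet> (x - 0)))\<bar>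
        \<le> C * (5 / 8 * (norm x)\<^sup>2 * c)"
      unfolding abs_mult using C_pos by (intro mult_mono) auto
  qed simp
  then show ?thesis by (simp add: mult_ac)
qed

lemma has_derivative_P_integral: "(P_integral \<alpha> \<phi> has_derivative (*v) D) (at 0)"
  unfolding has_derivative_at_alt
proof (intro conjI allI impI)
  show "bounded_linear ((*v) D)" by (simp add: linear_conv_bounded_linear[symmetric])
  fix e :: real assume "e > 0"
  define k where "k = 5 / 8 * (C * c) * M"
  have k: "k > 0" using C_pos c_pos Mpos by (simp add: k_def)
  \<comment> \<open>The first entry keeps \<open>y\<close> where the remainder estimate holds, the
    second turns \<open>k * norm y\<close> into at most \<open>e\<close>.\<close>
  define d where "d = min (1 / (6 * (s + 3))) (e / k)"
  have "d > 0" using s_ge k \<open>e > 0\<close> by (simp add: d_def)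
  moreover have "norm (P_integral \<alpha> \<phi> y - P_integral \<alpha> \<phi> 0 - D *v (y - 0)) \<le> e * norm (y - 0)"
    if "norm (y - 0) < d" for y :: "real^'n"
  proof -
    have y: "norm y \<le> 1 / (6 * (s + 3))" "norm y \<le> e / k" using that by (auto simp: d_def)
    have "norm y * (s + 3) \<le> 1 / 6" using y(1) s_ge by (simp add: field_simps)
    from P_integral_remainder[OF this]
    have "norm (P_integral \<alpha> \<phi> y - P_integral \<alpha> \<phi> 0 - D *v y) \<le> (k * norm y) * norm y"
      by (simp add: k_def power2_eq_square mult_ac)
    also have "\<dots> \<le> e * norm y"
      using y(2) k by (intro mult_right_mono) (auto simp: field_simps)
    finally show ?thesis by simp
  qed
  ultimately show "\<exists>d>0. \<forall>y. norm (y - 0) < d \<longrightarrow>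
      norm (P_integral \<alpha> \<phi> y - P_integral \<alpha> \<phi> 0 - D *v (y - 0)) \<le> e * norm (y - 0)"
    by blast
qed

end

section \<open>The function G\<close>

text \<open>Ratio test in multiplicative form, so that a terminating series, whose terms eventually
  vanish, needs no separate case.\<close>

lemma summable_hyp2F1:
  fixes a b c z :: real
  assumes c: "c > 0" and z: "\<bar>z\<bar> < 1"
  shows "summable (\<lambda>k. pochhammer a k * pochhammer b k / (pochhammer c k * fact k) * z ^ k)"
proof -
  let ?f = "\<lambda>k. pochhammer a k * pochhammer b k / (pochhammer c k * fact k) * z ^ k"
  let ?q = "\<lambda>k. \<bar>(a + real k) * (b + real k) / ((c + real k) * (1 + real k)) * z\<bar>"
  have "((\<lambda>k. (a + real k) * (b + real k) / ((c + real k) * (1 + real k))) \<longlongrightarrow> 1) at_top"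
    by real_asymp
  then have "(?q \<longlongrightarrow> \<bar>1 * z\<bar>) sequentially"
    by (intro tendsto_intros)
  moreover obtain r where r: "\<bar>z\<bar> < r" "r < 1" using dense[OF z] by blast
  ultimately have "\<forall>\<^sub>F k in sequentially. ?q k < r"
    by (intro order_tendstoD(2)) auto
  then obtain N where N: "\<And>k. k \<ge> N \<Longrightarrow> ?q k < r"
    by (auto simp: eventually_sequentially)
  show ?thesis
  proof (rule summable_ratio_test[OF r(2)])
    fix k assume "N \<le> k"
    have "pochhammer c k > 0" using c by (rule pochhammer_pos)
    then have "?f (Suc k) = ((a + real k) * (b + real k) / ((c + real k) * (1 + real k)) * z) * ?f k"
      using c by (simp add: pochhammer_Suc field_simps)
    then have "norm (?f (Suc k)) = ?q k * norm (?f k)"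
      by (simp only: real_norm_def abs_mult)
    also have "\<dots> \<le> r * norm (?f k)"
      using N[OF \<open>N \<le> k\<close>] by (intro mult_right_mono) auto
    finally show "norm (?f (Suc k)) \<le> r * norm (?f k)" .
  qed
qed

lemma hyp2F1_0 [simp]: "hyp2F1 a b c 0 = 1"
  unfolding hyp2F1_def by (subst powser_zero) simp

lemma isCont_hyp2F1:
  assumes "c > 0" "\<bar>z\<bar> < 1"
  shows "isCont (hyp2F1 a b c) z"
proof -
  obtain r where r: "\<bar>z\<bar> < r" "r < 1" using dense[OF assms(2)] by blast
  have "summable (\<lambda>k. pochhammer a k * pochhammer b k / (pochhammer c k * fact k) * r ^ k)"
    using summable_hyp2F1[OF assms(1), of r] r by simp
  from isCont_powser[OF this, of z] r show ?thesis
    unfolding hyp2F1_def[abs_def] by simp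
qed

lemma continuous_on_hyp2F1_square:
  assumes "c > 0" "r < 1"
  shows "continuous_on {0..r} (\<lambda>t. hyp2F1 a b c (t\<^sup>2))"
proof (intro continuous_at_imp_continuous_on ballI)
  fix t assume "t \<in> {0..r}"
  then have "\<bar>t\<^sup>2\<bar> < 1" using assms by (simp add: abs_square_less_1)
  then show "isCont (\<lambda>t. hyp2F1 a b c (t\<^sup>2)) t"
    by (intro isCont_o2[OF _ isCont_hyp2F1[OF assms(1)]] isCont_power continuous_ident)
qed

text \<open>The numerator of g vanishes at 0, so the limit of g there is the numerator's derivative,
  which is the value assigned at t = 0.\<close>

lemma continuous_on_g_fun:
  assumes "r < 1"
  shows "continuous_on {0..r} (g_fun n \<alpha>)"
proof -
  define f where "f = (\<lambda>t. 2 * (1 + t\<^sup>2) powr ((real n + 2 - \<alpha>) / 2) - (1 - t) powr (real n + 2 - \<alpha>)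
           - (1 - t\<^sup>2) powr (1 - \<alpha>))"
  have "(f has_real_derivative (real n + 2 - \<alpha>)) (at 0)"
    unfolding f_def by (auto intro!: derivative_eq_intros)
  then have "((\<lambda>t. f t / t) \<longlongrightarrow> real n + 2 - \<alpha>) (at 0)"
    by (simp add: DERIV_def f_def)
  moreover have "\<forall>\<^sub>F t in at 0. f t / t = g_fun n \<alpha> t"
    by (auto simp: g_fun_def f_def eventually_at_filter)
  ultimately have "(g_fun n \<alpha> \<longlongrightarrow> real n + 2 - \<alpha>) (at 0)"
    by (rule Lim_transform_eventually)
  then have lim: "(g_fun n \<alpha> \<longlongrightarrow> g_fun n \<alpha> 0) (at 0)"
    by (simp add: g_fun_def)
  show ?thesis
  proof (intro continuous_at_imp_continuous_on ballI)
    fix t assume t: "t \<in> {0..r}"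
    show "isCont (g_fun n \<alpha>) t"
    proof (cases "t = 0")
      case True
      then show ?thesis using lim by (simp add: isCont_def)
    next
      case False
      have "1 + t\<^sup>2 \<noteq> 0" by (metis add_pos_nonneg less_irrefl zero_le_power2 zero_less_one)
      moreover have "t\<^sup>2 < 1" using t assms by (simp add: abs_square_less_1)
      ultimately have "isCont (\<lambda>t. f t / t) t"
        unfolding f_def using t False assms by (intro continuous_intros) auto
      moreover have "\<forall>\<^sub>F x in nhds t. f x / x = g_fun n \<alpha> x"
        using t1_space_nhds[OF False] by eventually_elim (simp add: g_fun_def f_def)
      ultimately show ?thesis using isCont_cong[of "\<lambda>t. f t / t" "g_fun n \<alpha>" t] by simp
    qed
  qed
qed

text \<open>A real supremum dominates its members only if the set is bounded above; here compactness
  provides the bound.\<close>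

lemma le_SUP_Icc_left:
  fixes f :: "real \<Rightarrow> real"
  assumes "continuous_on {0..r} f" "0 \<le> r"
  shows "f 0 \<le> (SUP t\<in>{0..r}. f t)"
proof (rule cSUP_upper)
  show "bdd_above (f ` {0..r})"
    using compact_continuous_image[OF assms(1) compact_Icc]
    by (intro bounded_imp_bdd_above compact_imp_bounded)
qed (use assms(2) in simp)

text \<open>Each supremum is at least the value at t = 0, that is 1, 1 and n + 2 - \<alpha>, and
  each power of 1 - r^2 in a denominator is at most 1.\<close>

lemma G_fun_ge:
  assumes n: "n \<ge> 1" and \<alpha>: "\<alpha> < 1" and r: "0 \<le> r" "r < 1"
  shows "G_fun n \<alpha> r \<ge> C_const n \<alpha> *
    (2 * (1 - \<alpha>) + (real n - \<alpha>) + (real n - \<alpha>) * (real n + 2 - \<alpha>))"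
proof -
  let ?C = "C_const n \<alpha>" and ?s = "real n - \<alpha>"
  let ?F1 = "\<lambda>t. hyp2F1 (\<alpha>/2) ((real n + \<alpha>)/2 - 1) (real n / 2) (t\<^sup>2)"
  let ?F2 = "\<lambda>t. hyp2F1 (\<alpha>/2 - 1) ((real n + \<alpha>)/2 - 2) (real n / 2) (t\<^sup>2)"
  have C: "?C > 0" using C_const_pos n \<alpha> by simp
  have s: "?s > 0" using n \<alpha> by linarith
  have n2: "real n / 2 > 0" using n by simp
  have u: "0 < 1 - r\<^sup>2" "1 - r\<^sup>2 \<le> 1" using r by (auto simp: abs_square_less_1)
  have S1: "1 \<le> (SUP t\<in>{0..r}. ?F1 t)"
    using le_SUP_Icc_left[OF continuous_on_hyp2F1_square[OF n2 r(2), of "\<alpha>/2" "(real n + \<alpha>)/2 - 1"] r(1)] by simp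
  have S2: "1 \<le> (SUP t\<in>{0..r}. ?F2 t)"
    using le_SUP_Icc_left[OF continuous_on_hyp2F1_square[OF n2 r(2), of "\<alpha>/2 - 1" "(real n + \<alpha>)/2 - 2"] r(1)] by simp
  have S3: "real n + 2 - \<alpha> \<le> (SUP t\<in>{0..r}. ?F2 t * g_fun n \<alpha> t)"
    using le_SUP_Icc_left[OF continuous_on_mult[OF continuous_on_hyp2F1_square[OF n2 r(2), of "\<alpha>/2 - 1" "(real n + \<alpha>)/2 - 2"]
        continuous_on_g_fun[OF r(2), of n \<alpha>]] r(1)]
    by (simp add: g_fun_def)
  have le: "c * m \<le> c / d * S" if "0 < d" "d \<le> 1" "m \<le> S" "0 \<le> c" "0 \<le> m" for c d m S :: real
  proof (rule mult_mono)
    show "c \<le> c / d" using that by (simp add: pos_le_divide_eq mult_left_le)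
  qed (use that in auto)
  have "2 * (1 - \<alpha>) * ?C * 1 \<le> 2 * (1 - \<alpha>) * ?C / (1 - r\<^sup>2) * (SUP t\<in>{0..r}. ?F1 t)"
    using u S1 C \<alpha> by (intro le) auto
  moreover have "?s * ?C * 1 \<le> ?s * ?C / (1 - r\<^sup>2)\<^sup>2 * (SUP t\<in>{0..r}. ?F2 t)"
    using u S2 C s by (intro le) (auto simp: power_le_one)
  moreover have "?s * ?C * (real n + 2 - \<alpha>)
      \<le> ?s * ?C / (1 - r\<^sup>2) powr (3 - \<alpha>) * (SUP t\<in>{0..r}. ?F2 t * g_fun n \<alpha> t)"
    using u S3 C s \<alpha> by (intro le powr_le1) auto
  ultimately show ?thesis unfolding G_fun_def by (simp add: algebra_simps)
qed

section \<open>The Gamma quotient in the root equation\<close>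

lemma Gamma_plus1_pos: "x > 0 \<Longrightarrow> Gamma (x + 1) = x * Gamma (x :: real)"
  by (rule Gamma_plus1) (auto dest: nonpos_Ints_nonpos)

text \<open>The functional equation reduces the claim to \<open>main\<close>, which follows by
  induction in steps of two: the new factors are (m - 1) / 2 on the left and m / 2 on the right. At
  n = 3 equality holds, and n = 4 amounts to pi \<le> 4.\<close>

lemma Gamma_half_ratio_le:
  assumes "n \<ge> 3"
  shows "sqrt pi * Gamma ((real n + 1) / 2) / Gamma (real n / 2) \<le> real n - 1"
proof -
  have base3: "Gamma (3 / 2 :: real) = sqrt pi / 2"
    using Gamma_plus1_pos[of "1/2 :: real"] by (simp add: Gamma_one_half_real)
  have G2: "Gamma (2 :: real) = 1"
    using Gamma_plus1_pos[of "1 :: real"] by simp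
  have main: "sqrt pi * Gamma ((real n - 1) / 2) \<le> 2 * Gamma (real n / 2)"
    using assms
  proof (induction n rule: less_induct)
    case (less n)
    consider "n = 3" | "n = 4" | "n \<ge> 5" using less.prems by linarith
    then show ?case
    proof cases
      case 1 then show ?thesis by (simp add: base3)
    next
      case 2 then show ?thesis using pi_less_4 by (simp add: base3 G2)
    next
      case 3
      define m where "m = n - 2"
      have m: "m < n" "m \<ge> 3" "real n = real m + 2" using 3 by (auto simp: m_def)
      have e1: "Gamma ((real n - 1) / 2) = (real m - 1) / 2 * Gamma ((real m - 1) / 2)"
        using Gamma_plus1_pos[of "(real m - 1) / 2"] m by (simp add: field_simps not_le)
      have e2: "Gamma (real n / 2) = real m / 2 * Gamma (real m / 2)"
        using Gamma_plus1_pos[of "real m / 2"] m by (simp add: field_simps)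
      have "sqrt pi * ((real m - 1) / 2 * Gamma ((real m - 1) / 2)) \<le> real m / 2 * (2 * Gamma (real m / 2))"
        unfolding mult.left_commute[of "sqrt pi"]
      proof (rule mult_mono)
        have "Gamma ((real m - 1) / 2) > 0" using m by (intro Gamma_real_pos) auto
        then show "0 \<le> sqrt pi * Gamma ((real m - 1) / 2)" by simp
      qed (use less.IH[OF m(1,2)] m in auto)
      then show ?thesis unfolding e1 e2 by (simp only: mult.left_commute[of 2])
    qed
  qed
  have "Gamma ((real n + 1) / 2) = (real n - 1) / 2 * Gamma ((real n - 1) / 2)"
    using Gamma_plus1_pos[of "(real n - 1) / 2"] assms by (simp add: field_simps not_le)
  then have "sqrt pi * Gamma ((real n + 1) / 2) = (real n - 1) / 2 * (sqrt pi * Gamma ((real n - 1) / 2))"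
    by simp
  also have "\<dots> \<le> (real n - 1) / 2 * (2 * Gamma (real n / 2))"
    using main assms by (intro mult_left_mono) auto
  finally have "sqrt pi * Gamma ((real n + 1) / 2) \<le> (real n - 1) * Gamma (real n / 2)"
    by simp
  moreover have "Gamma (real n / 2) > 0" using assms by (intro Gamma_real_pos) auto
  ultimately show ?thesis by (simp add: pos_divide_le_eq)
qed

section \<open>Univalence and covering\<close>

text \<open>Two points with the same image would contradict m < l. For the covering, the part of the
  image inside \<open>ball 0 R\<close> is open by invariance of domain and relatively closed because
  the boundary sphere is mapped outside \<open>ball 0 R\<close>; connectedness makes it the whole
  ball.\<close>

lemma near_linear_univalent_covering:
  fixes u :: "'a::euclidean_space \<Rightarrow> 'a" and L :: "'a \<Rightarrow> 'a"
  assumes L: "linear L" "\<And>h. norm (L h) \<ge> l * norm h" and ml: "m < l" and r: "r > 0"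
    and near: "\<And>x y. norm x \<le> r \<Longrightarrow> norm y \<le> r \<Longrightarrow> norm (u x - u y - L (x - y)) \<le> m * norm (x - y)"
    and u0: "u 0 = 0" and bd: "\<And>x. norm x = r \<Longrightarrow> R \<le> norm (u x)"
  shows "inj_on u (ball 0 r) \<and> ball 0 R \<subseteq> u ` ball 0 r"
proof
  show inj: "inj_on u (ball 0 r)"
  proof (rule inj_onI)
    fix x y assume xy: "x \<in> ball 0 r" "y \<in> ball 0 r" "u x = u y"
    have "l * norm (x - y) \<le> norm (L (x - y))" by (rule L)
    also have "\<dots> \<le> m * norm (x - y)" using near[of x y] xy by simp
    finally have "(l - m) * norm (x - y) \<le> 0" by (simp add: algebra_simps)
    then show "x = y" using ml by (simp add: mult_le_0_iff)
  qed
  have cont: "continuous_on (cball 0 r) u"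
  proof -
    obtain B where B: "\<And>h. norm (L h) \<le> B * norm h"
      using linear_bounded[OF L(1)] by blast
    \<comment> \<open>Absolute values, because a Lipschitz constant has to be nonnegative.\<close>
    have lip: "dist (u x) (u y) \<le> (\<bar>m\<bar> + \<bar>B\<bar>) * dist x y" if "x \<in> cball 0 r" "y \<in> cball 0 r" for x y
    proof -
      have "norm (u x - u y) \<le> norm (u x - u y - L (x - y)) + norm (L (x - y))"
        using norm_triangle_ineq[of "u x - u y - L (x - y)" "L (x - y)"] by simp
      also have "\<dots> \<le> m * norm (x - y) + B * norm (x - y)"
        using near[of x y] B that by (intro add_mono) auto
      also have "\<dots> \<le> (\<bar>m\<bar> + \<bar>B\<bar>) * norm (x - y)"
        unfolding distrib_right by (intro add_mono mult_right_mono) auto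
      finally show ?thesis by (simp add: dist_norm)
    qed
    have "(\<bar>m\<bar> + \<bar>B\<bar>)-lipschitz_on (cball 0 r) u"
      using lip by (intro lipschitz_onI) auto
    then show ?thesis by (rule lipschitz_on_continuous_on)
  qed
  show "ball 0 R \<subseteq> u ` ball 0 r"
  proof (cases "R > 0")
    case True
    let ?T = "u ` ball 0 r \<inter> ball 0 R"
    have "open (u ` ball 0 r)"
      using cont inj by (intro invariance_of_domain) (auto intro: continuous_on_subset)
    then have "openin (top_of_set (ball 0 R)) ?T" by (auto simp: openin_open)
    moreover have "?T = u ` cball 0 r \<inter> ball 0 R"
      using bd by (fastforce simp: le_less)
    then have "closedin (top_of_set (ball 0 R)) ?T"
      using compact_imp_closed[OF compact_continuous_image[OF cont compact_cball]]
      by (auto simp: closedin_closed)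
    moreover have "0 \<in> ?T" using u0 r True by force
    ultimately have "?T = ball 0 R"
      using connected_ball[of "0 :: 'a" R] unfolding connected_clopen by blast
    then show ?thesis by blast
  qed (simp add: ball_empty)
qed

theorem theorem1p3:
  fixes u \<phi> :: "real^'n \<Rightarrow> real^'n" and \<alpha> M r\<^sub>0 :: real
  assumes n3: "CARD('n) \<ge> 3"
    and alpha: "\<alpha> < 1"
    and Mpos: "M > 0"
    and phi_meas: "\<phi> \<in> borel_measurable sphere_measure"
    and phi_bound: "AE \<zeta> in sphere_measure. norm (\<phi> \<zeta>) \<le> M"
    and u_def: "\<forall>x\<in>ball 0 1. u x = P_integral \<alpha> \<phi> x"
    and u0: "u 0 = 0"
    and J0: "det (jacobian u (at 0)) = 1"
    and r0_range: "0 < r\<^sub>0" "r\<^sub>0 < 1"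
    and r0_root: "M ^ CARD('n) * r\<^sub>0 * G_fun CARD('n) \<alpha> r\<^sub>0 =
        (sqrt pi * Gamma ((real CARD('n) + 1) / 2)
          / ((real CARD('n) - \<alpha>) * C_const CARD('n) \<alpha> * Gamma (real CARD('n) / 2))) ^ (CARD('n) - 1)"
    and r0_least: "\<forall>r. 0 < r \<and> r < r\<^sub>0 \<longrightarrow>
        M ^ CARD('n) * r * G_fun CARD('n) \<alpha> r \<noteq>
        (sqrt pi * Gamma ((real CARD('n) + 1) / 2)
          / ((real CARD('n) - \<alpha>) * C_const CARD('n) \<alpha> * Gamma (real CARD('n) / 2))) ^ (CARD('n) - 1)"
  shows "inj_on u (ball 0 r\<^sub>0) \<and>
         ball 0 (M / 2 * r\<^sub>0\<^sup>2 * G_fun CARD('n) \<alpha> r\<^sub>0) \<subseteq> u ` ball 0 r\<^sub>0"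
proof -
  define a s C where "a = 1 - \<alpha>" and "s = real CARD('n) - \<alpha>" and "C = C_const CARD('n) \<alpha>"
  define c where "c = 2 * a + s + s * (s + 2)"
  define D where "D = (s * C) *\<^sub>R moment_matrix \<phi>"
  interpret bounded_poisson \<phi> \<alpha> M a s C c D
    using n3 alpha Mpos phi_meas phi_bound a_def s_def C_def c_def D_def by unfold_locales
  let ?n = "real CARD('n)"
  define m where "m = CARD('n) - 1"
  have m: "real m = ?n - 1" and cardn: "CARD('n) = Suc m" using n3 by (auto simp: m_def of_nat_diff)
  have m0: "real m > 0" using n3 by (simp add: m_def)
  define G where "G = G_fun CARD('n) \<alpha> r\<^sub>0"
  define N where "N = s * C * M"
  define K where "K = M * r\<^sub>0 * G"
  have N0: "N > 0" using s_ge C_pos Mpos by (simp add: N_def)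
  have Gc: "C * c \<le> G"
    using G_fun_ge[of "CARD('n)" \<alpha> r\<^sub>0] n3 alpha r0_range by (simp add: G_def a_def s_def C_def c_def algebra_simps)
  have G0: "G > 0" using Gc C_pos c_pos by (meson less_le_trans mult_pos_pos)
  have K0: "K > 0" using Mpos r0_range G0 by (simp add: K_def)

  have "(u has_derivative (*v) D) (at 0)"
    by (rule has_derivative_transform_within_open[OF has_derivative_P_integral, of "ball 0 1"])
      (use u_def in auto)
  then have "jacobian u (at 0) = D"
    by (simp add: jacobian_def frechet_derivative_at[symmetric])
  with J0 have detD: "det D = 1" by simp
  have nD: "(norm D)\<^sup>2 \<le> N\<^sup>2 / ?n"
  proof -
    have "(norm D)\<^sup>2 = (s * C)\<^sup>2 * (norm (moment_matrix \<phi>))\<^sup>2"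
      by (simp add: D_def power_mult_distrib)
    also have "\<dots> \<le> (s * C)\<^sup>2 * (M\<^sup>2 / ?n)"
      by (intro mult_left_mono norm_moment_matrix_le[OF phi_meas phi_bound]) simp
    finally show ?thesis by (simp add: N_def power_mult_distrib)
  qed
  \<comment> \<open>By \<open>det_square_le_norm\<close> a determinant of 1 forces the squared norm
    of \<open>D\<close> to be at least n, while \<open>nD\<close> bounds it by N^2 / n.\<close>
  have Nn: "N \<ge> ?n"
  proof (rule ccontr)
    assume "\<not> N \<ge> ?n"
    then have "N\<^sup>2 < ?n\<^sup>2" using N0 by (intro power_strict_mono) auto
    then have "N\<^sup>2 / ?n / ?n < 1" by (simp add: power2_eq_square divide_less_eq)
    then have "(N\<^sup>2 / ?n / ?n) ^ CARD('n) < 1" by (intro power_less_one_iff[THEN iffD2]) auto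
    moreover have "(det D)\<^sup>2 \<le> (N\<^sup>2 / ?n / ?n) ^ CARD('n)"
      by (rule order_trans[OF det_square_le_norm]) (intro power_mono divide_right_mono nD, auto)
    ultimately show False by (simp add: detD)
  qed

  \<comment> \<open>After cancelling one factor M into \<open>K\<close>, the root equation reads M^m
    K = (w / (s C))^m, where \<open>w\<close> is the Gamma quotient and m = n - 1.\<close>
  have K_le: "K \<le> (real m / N) ^ m"
  proof -
    define w where "w = sqrt pi * Gamma ((?n + 1) / 2) / Gamma (?n / 2)"
    have w: "0 \<le> w" "w \<le> real m"
      unfolding w_def m using Gamma_half_ratio_le[OF n3]
      by (auto intro!: divide_nonneg_nonneg mult_nonneg_nonneg less_imp_le[OF Gamma_real_pos])
    have "M ^ m * K = (w / (s * C)) ^ m"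
      using r0_root unfolding s_def[symmetric] C_def[symmetric] m_def[symmetric]
      by (simp add: K_def G_def w_def power_Suc[of M m, folded cardn] mult_ac)
    then have "K = (w / (s * C)) ^ m / M ^ m"
      using Mpos by (simp add: eq_divide_eq mult.commute)
    also have "\<dots> = (w / N) ^ m" by (simp add: N_def power_divide power_mult_distrib)
    also have "\<dots> \<le> (real m / N) ^ m"
      using w N0 by (intro power_mono divide_right_mono) auto
    finally show ?thesis .
  qed
  \<comment> \<open>Bernoulli's inequality for (1 + 1/m)^m. This factor 2 gives both
    \<open>K_half\<close> and the gain of \<surd>2 in \<open>unit\<close>.\<close>
  have two: "2 \<le> (?n / real m) ^ m"
    using Bernoulli_inequality[of "1 / real m" m] m0 unfolding cardn by (simp add: field_simps)
  have K_half: "K \<le> 1 / 2"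
  proof -
    have "K \<le> (real m / ?n) ^ m"
      using K_le Nn m0 N0 by (elim order_trans) (intro power_mono divide_left_mono, auto)
    also have "\<dots> = 1 / (?n / real m) ^ m" by (simp add: power_divide)
    also have "\<dots> \<le> 1 / 2" using two by (intro divide_left_mono) auto
    finally show ?thesis .
  qed
  \<comment> \<open>Dropping 2 a from \<open>c\<close> leaves s (s + 3), so \<open>K\<close> is at
    least \<open>r\<^sub>0 * (s + 3) * N\<close>. With K \<le> 1/2 and N \<ge> 3 this gives
    1/6.\<close>
  have r0: "r\<^sub>0 * (s + 3) \<le> 1 / 6"
  proof -
    have "r\<^sub>0 * (s + 3) * N = M * r\<^sub>0 * (C * (s + s * (s + 2)))"
      by (simp add: N_def algebra_simps)
    also have "\<dots> \<le> K"
      unfolding K_def using Mpos r0_range C_pos a_pos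
      by (intro mult_left_mono order_trans[OF _ Gc]) (auto simp: c_def)
    also have "\<dots> \<le> 1 / 2" by (rule K_half)
    finally have "r\<^sub>0 * (s + 3) * N \<le> 1 / 2" .
    moreover have "r\<^sub>0 * (s + 3) * 3 \<le> r\<^sub>0 * (s + 3) * N"
      using Nn n3 r0_range s_ge by (intro mult_left_mono) auto
    ultimately show ?thesis by simp
  qed
  text \<open>Hadamard's inequality in an orthonormal frame containing \<open>h\<close>, with AM-GM applied to the other columns.\<close>
  have unit: "7 / 5 * K \<le> norm (D *v h)" if h: "norm h = 1" for h
  proof -
    define q where "q = N\<^sup>2 / ?n / real m"
    have q: "q > 0" using N0 m0 by (simp add: q_def)
    have "(det D)\<^sup>2 \<le> (norm (D *v h))\<^sup>2 * ((norm D)\<^sup>2 / real m) ^ m"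
      using det_square_le_norm_mult_vec[of h D] h n3 unfolding m[symmetric] m_def[symmetric] by simp
    also have "\<dots> \<le> (norm (D *v h))\<^sup>2 * q ^ m"
      unfolding q_def by (intro mult_left_mono power_mono divide_right_mono nD) auto
    finally have "1 / q ^ m \<le> (norm (D *v h))\<^sup>2"
      using q by (simp add: detD pos_divide_le_eq)
    \<comment> \<open>The right side equals (n/m)^m times the square of (m/N)^m: the first factor is
      at least 2 by \<open>two\<close>, the second at least the square of \<open>K\<close>.\<close>
    moreover have "2 * K\<^sup>2 \<le> 1 / q ^ m"
    proof -
      have "2 * K\<^sup>2 \<le> (?n / real m) ^ m * ((real m / N) ^ m)\<^sup>2"
        using two K_le K0 by (intro mult_mono power_mono) auto
      also have "\<dots> = (?n / real m * (real m / N)\<^sup>2) ^ m"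
        unfolding power_mult_distrib by (simp only: power_mult[symmetric] mult.commute[of m])
      also have "?n / real m * (real m / N)\<^sup>2 = 1 / q"
        using m0 N0 by (simp add: q_def power2_eq_square field_simps)
      finally show ?thesis by (simp add: power_divide)
    qed
    ultimately have "2 * K\<^sup>2 \<le> (norm (D *v h))\<^sup>2" by linarith
    \<comment> \<open>7/5 is a rational stand-in for \<surd>2, as 49/25 < 2; it still exceeds
      5/4.\<close>
    moreover have "(7 / 5 * K)\<^sup>2 \<le> 2 * K\<^sup>2" by (simp add: power_mult_distrib power2_eq_square)
    ultimately have "(7 / 5 * K)\<^sup>2 \<le> (norm (D *v h))\<^sup>2" by linarith
    then show ?thesis by (rule power2_le_imp_le) simp
  qed
  have lower: "7 / 5 * K * norm h \<le> norm (D *v h)" for h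
  proof (cases "h = 0")
    case False
    have "7 / 5 * K \<le> norm (D *v (h /\<^sub>R norm h))" using False by (intro unit) simp
    also have "\<dots> = norm (D *v h) / norm h"
      by (simp only: linear_scale[OF matrix_vector_mul_linear] norm_scaleR) (simp add: divide_inverse)
    finally show ?thesis using False by (simp add: pos_le_divide_eq)
  qed simp
  have KM: "5 / 4 * r\<^sub>0 * (C * c) * M \<le> 5 / 4 * K"
    using Gc Mpos r0_range by (simp add: K_def mult_ac mult_left_mono)
  have in_ball: "x \<in> ball 0 1" if "norm x \<le> r\<^sub>0" for x :: "real^'n" using that r0_range by simp
  show ?thesis
  proof (rule near_linear_univalent_covering[of "(*v) D" "7 / 5 * K" "5 / 4 * K"])
    show "linear ((*v) D)" by simp
    show "7 / 5 * K * norm h \<le> norm (D *v h)" for h by (rule lower)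
    show "5 / 4 * K < 7 / 5 * K" using K0 by simp
    show "norm (u x - u y - D *v (x - y)) \<le> 5 / 4 * K * norm (x - y)"
      if "norm x \<le> r\<^sub>0" "norm y \<le> r\<^sub>0" for x y
    proof -
      have "norm (u x - u y - D *v (x - y)) \<le> 5 / 4 * r\<^sub>0 * (C * c) * M * norm (x - y)"
        using P_integral_increment[OF r0 that] in_ball[OF that(1)] in_ball[OF that(2)] u_def by simp
      also have "\<dots> \<le> 5 / 4 * K * norm (x - y)"
        using KM by (rule mult_right_mono) simp
      finally show ?thesis .
    qed
    show "M / 2 * r\<^sub>0\<^sup>2 * G_fun CARD('n) \<alpha> r\<^sub>0 \<le> norm (u x)" if x: "norm x = r\<^sub>0" for x
    proof -
      have "norm (u x - D *v x) \<le> 5 / 8 * r\<^sub>0\<^sup>2 * (C * c) * M"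
        using P_integral_remainder[of x] r0 x in_ball[of x] in_ball[of 0] u_def u0 r0_range by simp
      also have "\<dots> = r\<^sub>0 / 2 * (5 / 4 * r\<^sub>0 * (C * c) * M)" by (simp add: power2_eq_square)
      also have "\<dots> \<le> r\<^sub>0 / 2 * (5 / 4 * K)" using KM r0_range by (intro mult_left_mono) auto
      finally have "norm (u x - D *v x) \<le> 5 / 8 * (K * r\<^sub>0)" by (simp add: mult_ac)
      moreover have "norm (D *v x) - norm (u x) \<le> norm (u x - D *v x)"
        by (metis norm_minus_commute norm_triangle_ineq2)
      moreover have "7 / 5 * (K * r\<^sub>0) \<le> norm (D *v x)" using lower[of x] x by simp
      moreover have "K * r\<^sub>0 > 0" using K0 r0_range by simp
      \<comment> \<open>7/5 - 5/8 = 31/40 exceeds 1/2, and \<open>K * r\<^sub>0 / 2\<close> is the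
        required covering radius.\<close>
      ultimately have "K * r\<^sub>0 / 2 \<le> norm (u x)" by linarith
      then show ?thesis by (simp add: K_def G_def power2_eq_square mult_ac)
    qed
  qed (use r0_range u0 in auto)
qed

end
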